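(* Let $\mathcal{F}$ be a family of graphs, each with at most four vertices, such that $\mathcal{F}\neq\{4P_1,C_4\}$ and $\mathcal{F}\neq\{4P_1,C_4,\text{claw}\}$. Then the class of $\mathcal{F}$-free graphs is not tame if and only if $\mathcal{F}'\trianglelefteq\mathcal{F}$ for one of the following families $\mathcal{F}'$: (i) $\mathcal{F}'=\{3P_1,\text{diamond}\}$; (ii) $\mathcal{F}'=\{\text{claw},K_4,C_4,\text{diamond}\}$; (iii) $\mathcal{F}'=\{K_3,C_4\}$.
   Context: All graphs are finite, simple, undirected, and have at least one vertex; members of families of graphs are considered up to isomorphism. For non-adjacent vertices $a,b$ of $G$, a set $S\subseteq V(G)\setminus\{a,b\}$ is an $a,b$-separator if $a$ and $b$ lie in different connected components of $G-S$; it is a minimal $a,b$-separator if no proper subset of $S$ is an $a,b$-separator. A minimal separator in $G$ is a set that is a minimal $a,b$-separator for some pair of non-adjacent vertices $a,b$. Let $s(G)$ denote the number of minimal separators in $G$. A class $\mathcal{G}$ of graphs is tame if there is a polynomial $p:\mathbb{R}\to\mathbb{R}$ such that $s(G)\le p(|V(G)|)$ for every $G\in\mathcal{G}$. A graph is $\mathcal{F}$-free if none of its induced subgraphs is isomorphic to a member of $\mathcal{F}$. For two families $\mathcal{F},\mathcal{F}'$ write $\mathcal{F}'\trianglelefteq\mathcal{F}$ if every $\mathcal{F}'$-free graph is also $\mathcal{F}$-free (equivalently, every graph in $\mathcal{F}$ contains an induced subgraph isomorphic to a member of $\mathcal{F}'$). $P_n, C_n, K_n$ denote the path, cycle, and complete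 graph on $n$ vertices; $kG$ is the disjoint union of $k$ copies of $G$. The claw is $K_{1,3}$; the diamond is $K_4$ minus one edge. *)

theory Defs
  imports Complex_Main "HOL-Computational_Algebra.Polynomial" "HOL-Library.Nat_Bijection"
begin

datatype 'a graph = Graph (verts: "'a set") (edges: "'a set set")

definition simple_graph :: "'a graph \<Rightarrow> bool" where
  "simple_graph G \<longleftrightarrow> finite (verts G) \<and> verts G \<noteq> {} \<and>
     (\<forall>e\<in>edges G. e \<subseteq> verts G \<and> card e = 2)"

definition adjacent :: "'a graph \<Rightarrow> 'a \<Rightarrow> 'a \<Rightarrow> bool" where
  "adjacent G u v \<longleftrightarrow> {u, v} \<in> edges G"

definition induced :: "'a graph \<Rightarrow> 'a set \<Rightarrow> 'a graph" where
  "induced G W = Graph (verts G \<inter> W) {e \<in> edges G. e \<subseteq> W}"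

definition delete_verts :: "'a graph \<Rightarrow> 'a set \<Rightarrow> 'a graph" where
  "delete_verts G S = induced G (verts G - S)"

definition isomorphic :: "'a graph \<Rightarrow> 'b graph \<Rightarrow> bool" (infix "\<simeq>" 50) where
  "G \<simeq> H \<longleftrightarrow> (\<exists>f. bij_betw f (verts G) (verts H) \<and>
     (\<forall>u\<in>verts G. \<forall>v\<in>verts G. adjacent G u v \<longleftrightarrow> adjacent H (f u) (f v)))"


subsection \<open>Minimal separators and tame classes\<close>

definition connectivity :: "'a graph \<Rightarrow> ('a \<times> 'a) set" where
  "connectivity G =
     {(u, v). u \<in> verts G \<and> v \<in> verts G \<and> (u, v) \<in> {(x, y). adjacent G x y}\<^sup>*}"

definition components :: "'a graph \<Rightarrow> 'a set set" where
  "components G = verts G // connectivity G"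

definition separator :: "'a graph \<Rightarrow> 'a \<Rightarrow> 'a \<Rightarrow> 'a set \<Rightarrow> bool" where
  "separator G a b S \<longleftrightarrow> S \<subseteq> verts G - {a, b} \<and>
     (\<exists>A\<in>components (delete_verts G S). \<exists>B\<in>components (delete_verts G S).
        a \<in> A \<and> b \<in> B \<and> A \<noteq> B)"

definition minimal_ab_separator :: "'a graph \<Rightarrow> 'a \<Rightarrow> 'a \<Rightarrow> 'a set \<Rightarrow> bool" where
  "minimal_ab_separator G a b S \<longleftrightarrow>
     separator G a b S \<and> (\<forall>T. T \<subset> S \<longrightarrow> \<not> separator G a b T)"

definition minimal_separators :: "'a graph \<Rightarrow> 'a set set" where
  "minimal_separators G =
     {S. \<exists>a\<in>verts G. \<exists>b\<in>verts G. a \<noteq> b \<and> \<not> adjacent G a b \<and> minimal_ab_separator G a b S}"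

definition num_minimal_separators :: "'a graph \<Rightarrow> nat" where
  "num_minimal_separators G = card (minimal_separators G)"

definition tame :: "'a graph set \<Rightarrow> bool" where
  "tame \<G> \<longleftrightarrow> (\<exists>p :: real poly. \<forall>G\<in>\<G>.
     real (num_minimal_separators G) \<le> poly p (real (card (verts G))))"


subsection \<open>Families of graphs\<close>

text \<open>
  Families and classes of graphs are sets of graphs with vertices in \<^typ>\<open>nat\<close>; by
  \<open>ex_nat_graph\<close> below, this covers every finite simple graph up to isomorphism.
\<close>

definition free_graphs :: "nat graph set \<Rightarrow> nat graph set" where
  "free_graphs \<F> = {G. simple_graph G \<and> \<not> (\<exists>W\<subseteq>verts G. \<exists>H\<in>\<F>. induced G W \<simeq> H)}"

definition family_le :: "nat graph set \<Rightarrow> nat graph set \<Rightarrow> bool" (infix "\<unlhd>" 50) where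
  "\<F>' \<unlhd> \<F> \<longleftrightarrow> free_graphs \<F>' \<subseteq> free_graphs \<F>"

text \<open>Equality of families whose members are considered up to isomorphism.\<close>

definition family_eq :: "nat graph set \<Rightarrow> nat graph set \<Rightarrow> bool" (infix "\<doteq>" 50) where
  "\<F> \<doteq> \<F>' \<longleftrightarrow> (\<forall>G\<in>\<F>. \<exists>H\<in>\<F>'. G \<simeq> H) \<and> (\<forall>H\<in>\<F>'. \<exists>G\<in>\<F>. G \<simeq> H)"


subsection \<open>Specific graphs\<close>

definition path_graph :: "nat \<Rightarrow> nat graph" where
  "path_graph n = Graph {..<n} {{i, i + 1} | i. i + 1 < n}"

text \<open>A cycle only for \<^prop>\<open>n \<ge> 3\<close>.\<close>

definition cycle_graph :: "nat \<Rightarrow> nat graph" where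
  "cycle_graph n = Graph {..<n} {{i, (i + 1) mod n} | i. i < n}"

definition complete_graph :: "nat \<Rightarrow> nat graph" where
  "complete_graph n = Graph {..<n} {{i, j} | i j. i < n \<and> j < n \<and> i \<noteq> j}"

definition complete_bipartite :: "nat \<Rightarrow> nat \<Rightarrow> nat graph" where
  "complete_bipartite m n = Graph {..<m + n} {{i, j} | i j. i < m \<and> m \<le> j \<and> j < m + n}"

text \<open>The vertex \<open>v\<close> of the \<open>i\<close>-th copy is encoded as \<^term>\<open>prod_encode (i, v)\<close>.\<close>

definition copies :: "nat \<Rightarrow> nat graph \<Rightarrow> nat graph" where
  "copies k G = Graph (prod_encode ` ({..<k} \<times> verts G))
     {(\<lambda>v. prod_encode (i, v)) ` e | i e. i < k \<and> e \<in> edges G}"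

definition claw :: "nat graph" where
  "claw = complete_bipartite 1 3"

definition diamond :: "nat graph" where
  "diamond = Graph (verts (complete_graph 4)) (edges (complete_graph 4) - {{0, 1}})"


subsection \<open>Basic facts\<close>

lemma ex_nat_graph:
  fixes G :: "'a graph"
  assumes "simple_graph G"
  shows "\<exists>H :: nat graph. simple_graph H \<and> G \<simeq> H"
proof -
  have "finite (verts G)" using assms by (simp add: simple_graph_def)
  then obtain f :: "'a \<Rightarrow> nat" where f: "inj_on f (verts G)"
    using finite_imp_inj_to_nat_seg by metis
  define H where "H = Graph (f ` verts G) ((`) f ` edges G)"
  have sub: "e \<subseteq> verts G" "card e = 2" if "e \<in> edges G" for e
    using assms that by (auto simp: simple_graph_def)
  have "simple_graph H"
    unfolding simple_graph_def
  proof (intro conjI ballI)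
    fix e assume "e \<in> edges H"
    then obtain d where d: "d \<in> edges G" "e = f ` d" by (auto simp: H_def)
    show "e \<subseteq> verts H" using sub(1)[OF d(1)] d(2) by (auto simp: H_def)
    show "card e = 2"
      using sub[OF d(1)] inj_on_subset[OF f] d(2) by (simp add: card_image)
  qed (use assms in \<open>simp_all add: simple_graph_def H_def\<close>)
  moreover have "adjacent G u v \<longleftrightarrow> adjacent H (f u) (f v)"
    if "u \<in> verts G" "v \<in> verts G" for u v
  proof
    assume "adjacent G u v"
    then have "f ` {u, v} \<in> edges H"
      unfolding adjacent_def H_def graph.sel by (rule imageI)
    then show "adjacent H (f u) (f v)"
      by (simp add: adjacent_def)
  next
    assume "adjacent H (f u) (f v)"
    then obtain e where e: "e \<in> edges G" "f ` {u, v} = f ` e"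
      by (auto simp: adjacent_def H_def)
    then have "{u, v} = e"
      using inj_on_image_eq_iff[OF f, of "{u, v}" e] sub that by auto
    with e show "adjacent G u v" by (simp add: adjacent_def)
  qed
  ultimately show ?thesis
    using f by (intro exI[of _ H]) (auto simp: isomorphic_def H_def bij_betw_def)
qed

lemma simple_graph_path_graph: "n \<ge> 1 \<Longrightarrow> simple_graph (path_graph n)"
  by (auto simp: simple_graph_def path_graph_def lessThan_empty_iff)

lemma simple_graph_cycle_graph: "n \<ge> 3 \<Longrightarrow> simple_graph (cycle_graph n)"
proof -
  assume n: "n \<ge> 3"
  have "i \<noteq> (i + 1) mod n" if "i < n" for i
    using n that by (cases "i + 1 = n") auto
  then have "card {i, (i + 1) mod n} = 2" if "i < n" for i
    using that by (metis card_2_iff)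
  with n show ?thesis
    by (auto simp: simple_graph_def cycle_graph_def lessThan_empty_iff)
qed

lemma simple_graph_complete_graph: "n \<ge> 1 \<Longrightarrow> simple_graph (complete_graph n)"
  by (auto simp: simple_graph_def complete_graph_def lessThan_empty_iff)

lemma simple_graph_complete_bipartite:
  "m + n \<ge> 1 \<Longrightarrow> simple_graph (complete_bipartite m n)"
  by (auto simp: simple_graph_def complete_bipartite_def lessThan_empty_iff card_insert_if)

lemma simple_graph_copies:
  "k \<ge> 1 \<Longrightarrow> simple_graph G \<Longrightarrow> simple_graph (copies k G)"
  unfolding simple_graph_def copies_def
  by (auto simp: lessThan_empty_iff card_image inj_on_def)

lemma simple_graph_claw: "simple_graph claw"
  by (simp add: claw_def simple_graph_complete_bipartite)

lemma simple_graph_diamond: "simple_graph diamond"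
  using simple_graph_complete_graph[of 4] by (auto simp: simple_graph_def diamond_def)

end

theory Submission
  imports Defs "HOL-Library.Ramsey"
begin

text \<open>
  \<^bold>\<open>Each obstruction gives a class that is not tame.\<close> Take two copies of a base graph and join a set \<open>M\<close>
  of vertices of one copy to the same set in the other by a matching. If the base graph minus \<open>M\<close> is
  connected and every vertex of \<open>M\<close> has a neighbour outside \<open>M\<close>, then choosing one end of every
  matching edge gives a minimal separator between the two copies, so there are at least
  \<open>2 ^ card M\<close> of them (\<open>many_minimal_separators\<close>). For a complete graph, a star and the line graph of
  a caterpillar as base graph the number of vertices is linear in \<open>card M\<close>, and the resulting graphs
  are \<open>{3P\<^sub>1, diamond}\<close>-free, \<open>{K\<^sub>3, C\<^sub>4}\<close>-free and \<open>{claw, K\<^sub>4, C\<^sub>4, diamond}\<close>-free, respectively.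

  \<^bold>\<open>Conversely,\<close> if none of the three relations holds, then \<open>\<F>\<close> contains, for each of the three
  families, a graph without induced subgraph from that family. Every graph on at most four vertices is
  an induced subgraph of a suitable one of the eleven graphs on four vertices (\<open>small_graph_cases\<close>), so
  there are few combinations of forbidden subgraphs to treat: \<open>P\<^sub>4\<close>; \<open>2P\<^sub>2\<close>; the co-diamond
  \<open>P\<^sub>2 + 2P\<^sub>1\<close> or \<open>P\<^sub>3 + P\<^sub>1\<close> with one of \<open>K\<^sub>3 + P\<^sub>1\<close>, paw, \<open>K\<^sub>4\<close>, \<open>C\<^sub>4\<close>; \<open>4P\<^sub>1\<close> with one of
  \<open>K\<^sub>3 + P\<^sub>1\<close>, paw, \<open>K\<^sub>4\<close>; the claw with \<open>K\<^sub>3 + P\<^sub>1\<close> or the paw; and \<open>{4P\<^sub>1, C\<^sub>4, diamond}\<close>, which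
  occurs because the families \<open>{4P\<^sub>1, C\<^sub>4}\<close> and \<open>{4P\<^sub>1, C\<^sub>4, claw}\<close> are excluded.

  In each of these cases every minimal separator \<open>S\<close> is determined by boundedly many vertices, so there
  are polynomially many (\<open>tame_if_describable\<close>). Let \<open>A\<close> and \<open>B\<close> be two components of \<open>G - S\<close> in which
  every vertex of \<open>S\<close> has a neighbour; then \<open>S\<close> is the neighbourhood of \<open>A\<close>, and of \<open>B\<close>. If \<open>A\<close>, \<open>B\<close>
  or \<open>S\<close> is bounded, this describes \<open>S\<close>. Without \<open>P\<^sub>4\<close>, \<open>S\<close> is the common neighbourhood of any vertex
  of \<open>A\<close> and any vertex of \<open>B\<close>; without \<open>2P\<^sub>2\<close>, one of \<open>A\<close>, \<open>B\<close> is a single vertex. Without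
  \<open>P\<^sub>3 + P\<^sub>1\<close> or without the co-diamond, \<open>A\<close> and \<open>B\<close> are cliques or one of them is a vertex; without
  \<open>K\<^sub>3 + P\<^sub>1\<close> or without the paw, they have no triangles if \<open>S\<close> is not empty; without \<open>4P\<^sub>1\<close>, Ramsey's
  theorem bounds sets with bounded cliques, and if \<open>C\<^sub>4\<close> and the diamond are forbidden as well, then
  \<open>S\<close> has no \<open>K\<^sub>4\<close> (\<open>no_K4_in_separator\<close>).

  These facts combine to bounds except in two situations. If \<open>A\<close> and \<open>B\<close> are cliques and there is no
  induced \<open>C\<^sub>4\<close>, then either \<open>S\<close> is a clique and the common neighbourhood of two vertices, or the common
  neighbours of two non-adjacent vertices of \<open>S\<close>, with those seen by two further vertices removed, form
  \<open>A\<close> or \<open>B\<close> up to at most two vertices (\<open>nonadjacent_pair_describable\<close>). If \<open>G\<close> is claw-free and \<open>A\<close>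
  and \<open>B\<close> have no triangles, they are paths or cycles, and if none of them is small, \<open>S\<close> is attached
  only to their ends (\<open>claw_free_attach\<close>).
\<close>

section \<open>Minimal separators and their full components\<close>

lemma adjacent_commute: "adjacent G x y \<longleftrightarrow> adjacent G y x"
  by (simp add: adjacent_def insert_commute)

lemma adjacentD:
  assumes "simple_graph G" "adjacent G x y"
  shows "x \<in> verts G" "y \<in> verts G" "x \<noteq> y"
  using assms by (auto simp: simple_graph_def adjacent_def card_insert_if dest!: bspec split: if_splits)

definition avoiding :: "'a graph \<Rightarrow> 'a set \<Rightarrow> ('a \<times> 'a) set" where
  "avoiding G S = {(x, y). adjacent G x y \<and> x \<notin> S \<and> y \<notin> S}"

lemma sym_avoiding: "sym (avoiding G S)"
  by (auto simp: sym_def avoiding_def adjacent_commute)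

lemma avoiding_rtrancl_sym: "(x, y) \<in> (avoiding G S)\<^sup>* \<Longrightarrow> (y, x) \<in> (avoiding G S)\<^sup>*"
  using sym_rtrancl[OF sym_avoiding] by (meson symD)

lemma adjacent_delete_verts:
  assumes "simple_graph G"
  shows "adjacent (delete_verts G S) x y \<longleftrightarrow> (x, y) \<in> avoiding G S"
  using adjacentD[OF assms] by (auto simp: avoiding_def adjacent_def delete_verts_def induced_def)

lemma separator_iff:
  assumes "simple_graph G"
  shows "separator G a b S \<longleftrightarrow> a \<in> verts G \<and> b \<in> verts G \<and> S \<subseteq> verts G - {a, b} \<and>
    (a, b) \<notin> (avoiding G S)\<^sup>*"
proof -
  let ?r = "connectivity (delete_verts G S)"
  have V: "verts (delete_verts G S) = verts G - S"
    by (auto simp: delete_verts_def induced_def)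
  have r: "?r = {(u, v). u \<in> verts G - S \<and> v \<in> verts G - S \<and> (u, v) \<in> (avoiding G S)\<^sup>*}"
    using assms by (simp add: connectivity_def V adjacent_delete_verts)
  have eq: "equiv (verts G - S) ?r"
    unfolding r by (auto simp: equiv_def refl_on_def sym_def trans_def
        intro: avoiding_rtrancl_sym)
  have comp: "components (delete_verts G S) = (verts G - S) // ?r"
    by (simp add: components_def V)
  show ?thesis
  proof
    assume sep: "separator G a b S"
    then obtain A B where AB: "A \<in> (verts G - S) // ?r" "B \<in> (verts G - S) // ?r"
      "a \<in> A" "b \<in> B" "A \<noteq> B" and S: "S \<subseteq> verts G - {a, b}"
      by (auto simp: separator_def comp)
    have "a \<in> verts G" "b \<in> verts G"
      using AB eq by (auto dest: in_quotient_imp_subset)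
    moreover have "(a, b) \<notin> ?r"
      using AB eq quotient_eq_iff by metis
    ultimately show "a \<in> verts G \<and> b \<in> verts G \<and> S \<subseteq> verts G - {a, b} \<and>
        (a, b) \<notin> (avoiding G S)\<^sup>*"
      using S by (auto simp: r)
  next
    assume R: "a \<in> verts G \<and> b \<in> verts G \<and> S \<subseteq> verts G - {a, b} \<and>
        (a, b) \<notin> (avoiding G S)\<^sup>*"
    then have ab: "a \<in> verts G - S" "b \<in> verts G - S" "(a, b) \<notin> ?r"
      by (auto simp: r)
    then have "?r `` {a} \<noteq> ?r `` {b}"
      using eq_equiv_class[OF _ eq] by metis
    moreover have "?r `` {a} \<in> (verts G - S) // ?r" "?r `` {b} \<in> (verts G - S) // ?r"
      using ab by (auto intro: quotientI)
    moreover have "a \<in> ?r `` {a}" "b \<in> ?r `` {b}"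
      using ab by (auto simp: r)
    ultimately show "separator G a b S"
      using R unfolding separator_def comp by blast
  qed
qed

text \<open>
  Removing a minimal separator \<open>S\<close> leaves two components \<open>A\<close>, \<open>B\<close> in which every vertex of
  \<open>S\<close> has a neighbour. Connectedness is stated through cuts, because that is how it is used: a
  property that holds for some but not for all vertices of \<open>A\<close> changes along an edge of \<open>A\<close>.
\<close>

locale full_components =
  fixes G :: "'a graph" and S A B :: "'a set"
  assumes simple: "simple_graph G"
    and S_sub: "S \<subseteq> verts G" and A_sub: "A \<subseteq> verts G" and B_sub: "B \<subseteq> verts G"
    and A_nonempty: "A \<noteq> {}" and B_nonempty: "B \<noteq> {}"
    and A_disj: "A \<inter> S = {}" and B_disj: "B \<inter> S = {}" and AB_disj: "A \<inter> B = {}"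
    and A_closed: "\<And>x y. x \<in> A \<Longrightarrow> adjacent G x y \<Longrightarrow> y \<in> A \<union> S"
    and B_closed: "\<And>x y. x \<in> B \<Longrightarrow> adjacent G x y \<Longrightarrow> y \<in> B \<union> S"
    and A_full: "\<And>s. s \<in> S \<Longrightarrow> \<exists>a\<in>A. adjacent G s a"
    and B_full: "\<And>s. s \<in> S \<Longrightarrow> \<exists>b\<in>B. adjacent G s b"
    and A_cut: "\<And>X. X \<subseteq> A \<Longrightarrow> X \<noteq> {} \<Longrightarrow> X \<noteq> A \<Longrightarrow> \<exists>x\<in>X. \<exists>y\<in>A - X. adjacent G x y"
    and B_cut: "\<And>X. X \<subseteq> B \<Longrightarrow> X \<noteq> {} \<Longrightarrow> X \<noteq> B \<Longrightarrow> \<exists>x\<in>X. \<exists>y\<in>B - X. adjacent G x y"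

text \<open>
  By minimality, putting a vertex \<open>s\<close> of \<open>S\<close> back connects \<open>a\<close> with \<open>b\<close>, and the component of
  \<open>a\<close> can only be left through \<open>s\<close>.
\<close>

lemma minimal_separator_full_side:
  assumes G: "simple_graph G" and min: "minimal_ab_separator G a b S"
  defines "A \<equiv> {x. (a, x) \<in> (avoiding G S)\<^sup>*}"
  shows "A \<subseteq> verts G" "A \<inter> S = {}"
    and "\<And>x y. x \<in> A \<Longrightarrow> adjacent G x y \<Longrightarrow> y \<in> A \<union> S"
    and "\<And>s. s \<in> S \<Longrightarrow> \<exists>x\<in>A. adjacent G s x"
    and "\<And>X. X \<subseteq> A \<Longrightarrow> X \<noteq> {} \<Longrightarrow> X \<noteq> A \<Longrightarrow> \<exists>x\<in>X. \<exists>y\<in>A - X. adjacent G x y"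
proof -
  have sep: "a \<in> verts G" "b \<in> verts G" "S \<subseteq> verts G - {a, b}" "b \<notin> A"
    using min by (auto simp: minimal_ab_separator_def separator_iff[OF G] A_def)
  have AV: "x \<in> verts G \<and> x \<notin> S" if "x \<in> A" for x
  proof -
    have "(a, x) \<in> (avoiding G S)\<^sup>*" using that by (simp add: A_def)
    then show ?thesis
      by (induction rule: rtrancl_induct) (use sep adjacentD[OF G] in \<open>auto simp: avoiding_def\<close>)
  qed
  then show "A \<subseteq> verts G" "A \<inter> S = {}" by auto
  show closed: "y \<in> A \<union> S" if "x \<in> A" "adjacent G x y" for x y
  proof -
    have "y \<in> A" if "y \<notin> S"
    proof -
      have "(x, y) \<in> avoiding G S"
        using AV \<open>x \<in> A\<close> \<open>adjacent G x y\<close> that by (auto simp: avoiding_def)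
      then show ?thesis using \<open>x \<in> A\<close> by (auto simp: A_def intro: rtrancl_into_rtrancl)
    qed
    then show ?thesis by blast
  qed
  show "\<exists>x\<in>A. adjacent G s x" if s: "s \<in> S" for s
  proof (rule ccontr)
    assume no: "\<not> (\<exists>x\<in>A. adjacent G s x)"
    have "\<not> separator G a b (S - {s})"
      using min s by (auto simp: minimal_ab_separator_def)
    then have "(a, b) \<in> (avoiding G (S - {s}))\<^sup>*"
      using sep by (auto simp: separator_iff[OF G])
    then have "b \<in> A"
    proof (induction rule: rtrancl_induct)
      case base
      show ?case by (simp add: A_def)
    next
      case (step y z)
      then have "z \<in> A \<union> S" "z \<notin> S - {s}" "z \<noteq> s"
        using closed[of y z] no adjacent_commute[of G y z] by (auto simp: avoiding_def)
      then show ?case by auto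
    qed
    then show False using sep by simp
  qed
  show "\<exists>x\<in>X. \<exists>y\<in>A - X. adjacent G x y" if X: "X \<subseteq> A" "X \<noteq> {}" "X \<noteq> A" for X
  proof (rule ccontr)
    assume no: "\<not> (\<exists>x\<in>X. \<exists>y\<in>A - X. adjacent G x y)"
    have "x \<in> X \<longleftrightarrow> a \<in> X" if "x \<in> A" for x
    proof -
      have "(a, x) \<in> (avoiding G S)\<^sup>*" using that by (simp add: A_def)
      then show ?thesis
      proof (induction rule: rtrancl_induct)
        case (step y z)
        have "y \<in> A" "z \<in> A"
          using step.hyps by (auto simp: A_def intro: rtrancl_into_rtrancl)
        moreover have "adjacent G y z" "adjacent G z y"
          using step.hyps adjacent_commute[of G y z] by (auto simp: avoiding_def)
        ultimately have "y \<in> X \<longleftrightarrow> z \<in> X" using no by blast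
        then show ?case using step.IH by simp
      qed simp
    qed
    then show False using X by blast
  qed
qed

lemma minimal_separator_full_components:
  assumes G: "simple_graph G" and S: "S \<in> minimal_separators G"
  obtains A B where "full_components G S A B"
proof -
  obtain a b where min: "minimal_ab_separator G a b S"
    using S by (auto simp: minimal_separators_def)
  have sep_sym: "separator G a b T \<longleftrightarrow> separator G b a T" for T
    by (auto simp: separator_iff[OF G] intro: avoiding_rtrancl_sym)
  then have min': "minimal_ab_separator G b a S"
    using min by (simp add: minimal_ab_separator_def)
  define A where "A = {x. (a, x) \<in> (avoiding G S)\<^sup>*}"
  define B where "B = {x. (b, x) \<in> (avoiding G S)\<^sup>*}"
  note A = minimal_separator_full_side[OF G min, folded A_def]
  note B = minimal_separator_full_side[OF G min', folded B_def]
  have sep: "S \<subseteq> verts G" "(a, b) \<notin> (avoiding G S)\<^sup>*"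
    using min by (auto simp: minimal_ab_separator_def separator_iff[OF G])
  have "A \<inter> B = {}"
    using sep(2) avoiding_rtrancl_sym[of b _ G S] rtrancl_trans[of a _ "avoiding G S" b]
    by (auto simp: A_def B_def)
  moreover have "a \<in> A" "b \<in> B" by (auto simp: A_def B_def)
  ultimately have "full_components G S A B"
    using G sep(1) A B by unfold_locales auto
  then show ?thesis by (rule that)
qed

section \<open>Separators described by boundedly many vertices\<close>

definition nbhd :: "'a graph \<Rightarrow> 'a set \<Rightarrow> 'a set" where
  "nbhd G X = {y. y \<notin> X \<and> (\<exists>x\<in>X. adjacent G x y)}"

definition private_common_nbrs :: "'a graph \<Rightarrow> 'a \<Rightarrow> 'a \<Rightarrow> 'a \<Rightarrow> 'a \<Rightarrow> 'a set" where
  "private_common_nbrs G s t a c =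
     {v. adjacent G s v \<and> adjacent G t v \<and> \<not> adjacent G a v \<and> \<not> adjacent G c v}"

text \<open>
  The shapes in which minimal separators occur in the tame classes: small sets, neighbourhoods of
  small sets, separators attached to each of two components at no more than two vertices, and
  neighbourhoods of components that consist, up to two vertices, of the common neighbours of two
  vertices that a third and a fourth vertex do not see.
\<close>

definition describable :: "nat \<Rightarrow> 'a graph \<Rightarrow> 'a set set" where
  "describable k G =
     {X. X \<subseteq> verts G \<and> card X \<le> k} \<union> nbhd G ` {X. X \<subseteq> verts G \<and> card X \<le> k} \<union>
     {nbhd G {p, p'} \<inter> nbhd G {q, q'} | p p' q q'. {p, p', q, q'} \<subseteq> verts G} \<union>
     {nbhd G (private_common_nbrs G s t a c \<union> {b, b'}) | s t a c b b'.
        {s, t, a, c, b, b'} \<subseteq> verts G}"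

text \<open>
  Every shape is the image of a list of at most \<open>k\<close> vertices; the last one uses six vertices, which
  is where \<open>6 \<le> k\<close> comes from.
\<close>

lemma card_describable:
  assumes V: "finite (verts G)" and k: "6 \<le> k"
  shows "finite (describable k G)" "card (describable k G) \<le> 4 * (\<Sum>i\<le>k. card (verts G) ^ i)"
proof -
  define L where "L = {xs. set xs \<subseteq> verts G \<and> length xs \<le> k}"
  define f where "f xs = nbhd G {xs ! 0, xs ! 1} \<inter> nbhd G {xs ! 2, xs ! 3}" for xs
  define g where "g xs = nbhd G (private_common_nbrs G (xs ! 0) (xs ! 1) (xs ! 2) (xs ! 3) \<union>
    {xs ! 4, xs ! 5})" for xs
  have L: "finite L" "card L = (\<Sum>i\<le>k. card (verts G) ^ i)"
    unfolding L_def using V by (auto simp: finite_lists_length_le card_lists_length_le)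
  have small: "{X. X \<subseteq> verts G \<and> card X \<le> k} \<subseteq> set ` L"
  proof clarify
    fix X assume X: "X \<subseteq> verts G" "card X \<le> k"
    then obtain xs where "set xs = X" "length xs = card X"
      using V finite_subset distinct_card finite_distinct_list by metis
    then show "X \<in> set ` L" using X by (auto simp: L_def)
  qed
  have "{nbhd G {p, p'} \<inter> nbhd G {q, q'} | p p' q q'. {p, p', q, q'} \<subseteq> verts G} \<subseteq> f ` L"
  proof clarify
    fix p p' q q' assume "{p, p', q, q'} \<subseteq> verts G"
    then have "[p, p', q, q'] \<in> L" using k by (simp add: L_def)
    then show "nbhd G {p, p'} \<inter> nbhd G {q, q'} \<in> f ` L"
      by (rule rev_image_eqI) (simp add: f_def numeral_eq_Suc)
  qed
  moreover have "{nbhd G (private_common_nbrs G s t a c \<union> {b, b'}) | s t a c b b'.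
        {s, t, a, c, b, b'} \<subseteq> verts G} \<subseteq> g ` L"
  proof clarify
    fix s t a c b b' assume "{s, t, a, c, b, b'} \<subseteq> verts G"
    then have "[s, t, a, c, b, b'] \<in> L" using k by (simp add: L_def)
    then show "nbhd G (private_common_nbrs G s t a c \<union> {b, b'}) \<in> g ` L"
      by (rule rev_image_eqI) (simp add: g_def numeral_eq_Suc)
  qed
  ultimately have sub: "describable k G \<subseteq> set ` L \<union> (nbhd G \<circ> set) ` L \<union> f ` L \<union> g ` L"
    unfolding describable_def image_comp[symmetric]
    using small by (intro Un_mono image_mono) auto
  then show "finite (describable k G)"
    using L(1) by (auto intro: finite_subset)
  have "card (describable k G) \<le> card (set ` L \<union> (nbhd G \<circ> set) ` L \<union> f ` L \<union> g ` L)"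
    using sub L(1) by (intro card_mono) auto
  also have "\<dots> \<le> card (set ` L) + card ((nbhd G \<circ> set) ` L) + card (f ` L) + card (g ` L)"
    by (intro order_trans[OF card_Un_le] add_mono order_refl)
  also have "\<dots> \<le> card L + card L + card L + card L"
    using L(1) by (intro add_mono card_image_le)
  finally show "card (describable k G) \<le> 4 * (\<Sum>i\<le>k. card (verts G) ^ i)"
    by (simp add: L(2))
qed

lemma tame_if_describable:
  assumes "6 \<le> k" and "\<And>G. G \<in> \<G> \<Longrightarrow> simple_graph G"
    and "\<And>G. G \<in> \<G> \<Longrightarrow> minimal_separators G \<subseteq> describable k G"
  shows "tame \<G>"
  unfolding tame_def
proof (intro exI ballI)
  fix G assume G: "G \<in> \<G>"
  have V: "finite (verts G)" using assms(2)[OF G] by (simp add: simple_graph_def)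
  have "num_minimal_separators G \<le> 4 * (\<Sum>i\<le>k. card (verts G) ^ i)"
    unfolding num_minimal_separators_def
    using card_describable[OF V assms(1)] card_mono[OF _ assms(3)[OF G]] by linarith
  then have "real (num_minimal_separators G) \<le> real (4 * (\<Sum>i\<le>k. card (verts G) ^ i))"
    by (simp only: of_nat_le_iff)
  also have "\<dots> = poly (\<Sum>i\<le>k. monom 4 i) (real (card (verts G)))"
    by (simp add: poly_sum poly_monom sum_distrib_left)
  finally show "real (num_minimal_separators G) \<le> poly (\<Sum>i\<le>k. monom 4 i) (real (card (verts G)))" .
qed

section \<open>Induced subgraphs on four vertices\<close>

text \<open>
  An unlabelled graph on four vertices is given by the adjacencies \<open>ab, ac, ad, bc, bd, cd\<close> of one
  of its labellings.
\<close>

definition pattern :: "'a graph \<Rightarrow> 'a \<Rightarrow> 'a \<Rightarrow> 'a \<Rightarrow> 'a \<Rightarrow> bool list" where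
  "pattern G a b c d = [adjacent G a b, adjacent G a c, adjacent G a d,
     adjacent G b c, adjacent G b d, adjacent G c d]"

definition contains :: "'a graph \<Rightarrow> bool list \<Rightarrow> bool" where
  "contains G w \<longleftrightarrow> (\<exists>a b c d. {a, b, c, d} \<subseteq> verts G \<and> distinct [a, b, c, d] \<and>
     pattern G a b c d = w)"

definition "P4_pat = [True, False, False, True, False, True]"
definition "two_K2_pat = [True, False, False, False, False, True]"
definition "co_diamond_pat = [True, False, False, False, False, False]"
definition "P3_K1_pat = [True, False, False, True, False, False]"
definition "four_K1_pat = [False, False, False, False, False, False]"
definition "claw_pat = [True, True, True, False, False, False]"
definition "K3_K1_pat = [True, True, False, True, False, False]"
definition "paw_pat = [True, True, False, True, False, True]"
definition "K4_pat = [True, True, True, True, True, True]"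
definition "C4_pat = [True, False, True, True, False, True]"
definition "diamond_pat = [False, True, True, True, True, True]"

lemma containsI:
  assumes "{a, b, c, d} \<subseteq> verts G" "distinct [a, b, c, d]" "pattern G a b c d = w"
  shows "contains G w"
  unfolding contains_def using assms by blast

lemma simple_irrefl: "simple_graph G \<Longrightarrow> \<not> adjacent G x x"
  using adjacentD by metis

text \<open>
  The introduction rules below list only those distinctness and membership conditions that do not
  follow from the adjacencies.
\<close>

context
  fixes G :: "'a graph"
  assumes G: "simple_graph G"
begin

private abbreviation (input) edge (infix "\<frown>" 50) where "x \<frown> y \<equiv> adjacent G x y"

lemma contains_P4I:
  "\<lbrakk>a \<frown> b; b \<frown> c; c \<frown> d; \<not> a \<frown> c; \<not> a \<frown> d; \<not> b \<frown> d\<rbrakk> \<Longrightarrow> contains G P4_pat"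
  by (rule containsI[of a b c d])
    (auto simp: pattern_def P4_pat_def adjacent_commute adjacentD[OF G] simple_irrefl[OF G]
      adjacentD(2)[OF G, of c d])

lemma contains_two_K2I:
  "\<lbrakk>a \<frown> b; c \<frown> d; \<not> a \<frown> c; \<not> a \<frown> d; \<not> b \<frown> c; \<not> b \<frown> d\<rbrakk> \<Longrightarrow> contains G two_K2_pat"
  by (rule containsI[of a b c d])
    (auto simp: pattern_def two_K2_pat_def adjacent_commute adjacentD[OF G] simple_irrefl[OF G]
      adjacentD(2)[OF G, of a b] adjacentD(2)[OF G, of c d])

lemma contains_co_diamondI:
  "\<lbrakk>a \<frown> b; c \<in> verts G; d \<in> verts G; c \<noteq> d; \<not> a \<frown> c; \<not> a \<frown> d; \<not> b \<frown> c; \<not> b \<frown> d; \<not> c \<frown> d\<rbrakk>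
    \<Longrightarrow> contains G co_diamond_pat"
  by (rule containsI[of a b c d])
    (auto simp: pattern_def co_diamond_pat_def adjacent_commute adjacentD[OF G] simple_irrefl[OF G]
      adjacentD(2)[OF G, of a b])

lemma contains_P3_K1I:
  "\<lbrakk>a \<frown> b; b \<frown> c; a \<noteq> c; d \<in> verts G; \<not> a \<frown> c; \<not> a \<frown> d; \<not> b \<frown> d; \<not> c \<frown> d\<rbrakk>
    \<Longrightarrow> contains G P3_K1_pat"
  by (rule containsI[of a b c d])
    (auto simp: pattern_def P3_K1_pat_def adjacent_commute adjacentD[OF G] simple_irrefl[OF G]
      adjacentD(2)[OF G, of b c])

lemma contains_four_K1I:
  "\<lbrakk>{a, b, c, d} \<subseteq> verts G; distinct [a, b, c, d];
    \<not> a \<frown> b; \<not> a \<frown> c; \<not> a \<frown> d; \<not> b \<frown> c; \<not> b \<frown> d; \<not> c \<frown> d\<rbrakk> \<Longrightarrow> contains G four_K1_pat"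
  by (rule containsI[of a b c d]) (auto simp: pattern_def four_K1_pat_def)

lemma contains_clawI:
  "\<lbrakk>x \<frown> a; x \<frown> b; x \<frown> c; distinct [a, b, c]; \<not> a \<frown> b; \<not> a \<frown> c; \<not> b \<frown> c\<rbrakk>
    \<Longrightarrow> contains G claw_pat"
  by (rule containsI[of x a b c])
    (auto simp: pattern_def claw_pat_def adjacentD[OF G] simple_irrefl[OF G])

lemma contains_K3_K1I:
  "\<lbrakk>a \<frown> b; b \<frown> c; a \<frown> c; d \<in> verts G; \<not> a \<frown> d; \<not> b \<frown> d; \<not> c \<frown> d\<rbrakk> \<Longrightarrow> contains G K3_K1_pat"
  by (rule containsI[of a b c d])
    (auto simp: pattern_def K3_K1_pat_def adjacent_commute adjacentD[OF G] simple_irrefl[OF G]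
      adjacentD(2)[OF G, of b c])

lemma contains_pawI:
  "\<lbrakk>a \<frown> b; b \<frown> c; a \<frown> c; c \<frown> d; \<not> a \<frown> d; \<not> b \<frown> d\<rbrakk> \<Longrightarrow> contains G paw_pat"
  by (rule containsI[of a b c d])
    (auto simp: pattern_def paw_pat_def adjacent_commute adjacentD[OF G] simple_irrefl[OF G]
      adjacentD(2)[OF G, of c d])

lemma contains_K4I:
  "\<lbrakk>a \<frown> b; a \<frown> c; a \<frown> d; b \<frown> c; b \<frown> d; c \<frown> d\<rbrakk> \<Longrightarrow> contains G K4_pat"
  by (rule containsI[of a b c d])
    (auto simp: pattern_def K4_pat_def adjacentD[OF G] simple_irrefl[OF G])

lemma contains_C4I:
  "\<lbrakk>a \<frown> b; b \<frown> c; c \<frown> d; d \<frown> a; a \<noteq> c; b \<noteq> d; \<not> a \<frown> c; \<not> b \<frown> d\<rbrakk> \<Longrightarrow> contains G C4_pat"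
  by (rule containsI[of a b c d])
    (auto simp: pattern_def C4_pat_def adjacent_commute adjacentD[OF G] simple_irrefl[OF G]
      adjacentD(2)[OF G, of a d])

lemma contains_diamondI:
  "\<lbrakk>a \<noteq> b; \<not> a \<frown> b; a \<frown> c; a \<frown> d; b \<frown> c; b \<frown> d; c \<frown> d\<rbrakk> \<Longrightarrow> contains G diamond_pat"
  by (rule containsI[of a b c d])
    (auto simp: pattern_def diamond_pat_def adjacentD[OF G] simple_irrefl[OF G])

end

section \<open>Shape of the two components and of the separator\<close>

definition is_clique :: "'a graph \<Rightarrow> 'a set \<Rightarrow> bool" where
  "is_clique G X \<longleftrightarrow> (\<forall>x\<in>X. \<forall>y\<in>X. x \<noteq> y \<longrightarrow> adjacent G x y)"

definition triangle_free :: "'a graph \<Rightarrow> 'a set \<Rightarrow> bool" where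
  "triangle_free G X \<longleftrightarrow>
     (\<forall>x\<in>X. \<forall>y\<in>X. \<forall>z\<in>X. \<not> (adjacent G x y \<and> adjacent G y z \<and> adjacent G x z))"

lemma four_distinct:
  assumes "4 \<le> card X"
  shows "\<exists>x y z w. {x, y, z, w} \<subseteq> X \<and> distinct [x, y, z, w]"
proof -
  obtain Y where Y: "Y \<subseteq> X" "card Y = 4"
    using obtain_subset_with_card_n[OF assms] by metis
  then have "finite Y" by (simp add: card_ge_0_finite)
  then obtain xs where xs: "set xs = Y" "distinct xs"
    using finite_distinct_list by metis
  then have "length xs = 4" using Y distinct_card by metis
  then obtain x y z w where "xs = [x, y, z, w]"
    by (auto simp: numeral_eq_Suc length_Suc_conv)
  then have "{x, y, z, w} \<subseteq> X" "distinct [x, y, z, w]" using xs Y(1) by auto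
  then show ?thesis by blast
qed

text \<open>
  Ramsey's theorem yields a number for each vertex type separately, hence the type argument.
\<close>

definition ramsey_4_4 :: "'a itself \<Rightarrow> nat \<Rightarrow> bool" where
  "ramsey_4_4 _ r \<longleftrightarrow> (\<forall>(V :: 'a set) E. finite V \<and> r \<le> card V \<longrightarrow>
     (\<exists>R\<subseteq>V. card R = 4 \<and> clique R E \<or> card R = 4 \<and> indep R E))"

lemma ex_ramsey_4_4: "\<exists>r. ramsey_4_4 TYPE('a) r"
  using ramsey2[of 4 4] unfolding ramsey_4_4_def by metis

lemma ramsey_bound:
  assumes G: "simple_graph G" and X: "X \<subseteq> verts G" and r: "ramsey_4_4 TYPE('a) r"
    and indep: "\<not> contains (G :: 'a graph) four_K1_pat"
    and clique: "\<And>x y z w. {x, y, z, w} \<subseteq> X \<Longrightarrow> distinct [x, y, z, w] \<Longrightarrow>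
      is_clique G {x, y, z, w} \<Longrightarrow> False"
  shows "card X \<le> r"
proof (rule ccontr)
  assume "\<not> card X \<le> r"
  moreover have "finite X"
    using X G by (auto simp: simple_graph_def intro: finite_subset)
  ultimately obtain R where R: "R \<subseteq> X" "card R = 4" "clique R (edges G) \<or> indep R (edges G)"
    using r unfolding ramsey_4_4_def by (metis nat_le_linear)
  then obtain x y z w where xyzw: "{x, y, z, w} \<subseteq> R" "distinct [x, y, z, w]"
    using four_distinct[of R] by (metis order_refl)
  from R(3) show False
  proof
    assume "clique R (edges G)"
    then have "is_clique G {x, y, z, w}"
      using xyzw unfolding is_clique_def clique_def adjacent_def by blast
    then show False using clique xyzw R(1) by blast
  next
    assume "indep R (edges G)"
    then have "contains G four_K1_pat"
      using xyzw R(1) X unfolding indep_def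
      by (intro contains_four_K1I[OF G, of x y z w]) (auto simp: adjacent_def)
    then show False using indep by simp
  qed
qed

text \<open>
  A vertex with a neighbour in a triangle has two, since otherwise it is the pendant vertex of a
  paw; a further step away from the triangle would then also be a pendant vertex of a paw.
\<close>

lemma paw_free_triangle_dominates:
  assumes G: "simple_graph G" and paw: "\<not> contains G paw_pat"
    and T: "adjacent G x y" "adjacent G y z" "adjacent G x z"
  defines "D \<equiv> \<lambda>v. v \<in> {x, y, z} \<or> adjacent G v x \<or> adjacent G v y \<or> adjacent G v z"
  assumes Du: "D u" and uv: "adjacent G u v"
  shows "D v"
proof (rule ccontr)
  assume v: "\<not> D v"
  have nv: "\<not> adjacent G x v" "\<not> adjacent G y v" "\<not> adjacent G z v"
    using v adjacent_commute[of G] unfolding D_def by blast+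
  have u: "u \<notin> {x, y, z}"
    using v uv adjacent_commute[of G] unfolding D_def by blast
  have two: False if "adjacent G u p" "adjacent G u q" "adjacent G p q"
      "\<not> adjacent G p v" "\<not> adjacent G q v" for p q
    using contains_pawI[OF G, of p q u v] paw that uv adjacent_commute[of G u] by blast
  have one: "adjacent G u p \<or> adjacent G u q"
    if "adjacent G u t" "adjacent G t p" "adjacent G t q" "adjacent G p q" for t p q
    using contains_pawI[OF G, of p q t u] paw that adjacent_commute[of G] by blast
  show False
    using Du u T nv one[of x y z] one[of y x z] one[of z x y] two[of x y] two[of x z] two[of y z]
      adjacent_commute[of G y] adjacent_commute[of G z] unfolding D_def by blast
qed

context full_components
begin

abbreviation (input) edge (infix "\<frown>" 50) where "x \<frown> y \<equiv> adjacent G x y"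

lemma swap: "full_components G S B A"
  using full_components_axioms unfolding full_components_def by (simp add: Int_commute)

lemma edge_commute: "x \<frown> y \<longleftrightarrow> y \<frown> x"
  by (rule adjacent_commute)

lemma finite_A: "finite A"
  using simple A_sub by (auto simp: simple_graph_def intro: finite_subset)

lemma not_edge_AB: "a \<in> A \<Longrightarrow> b \<in> B \<Longrightarrow> \<not> a \<frown> b" "a \<in> A \<Longrightarrow> b \<in> B \<Longrightarrow> \<not> b \<frown> a"
  using A_closed B_closed AB_disj A_disj B_disj by blast+

lemma common_nbr_in_S: "a \<in> A \<Longrightarrow> b \<in> B \<Longrightarrow> a \<frown> x \<Longrightarrow> b \<frown> x \<Longrightarrow> x \<in> S"
  using A_closed[of a x] B_closed[of b x] AB_disj by auto

lemma S_eq_nbhd: "S = nbhd G A"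
  unfolding nbhd_def using A_closed A_full A_disj edge_commute by blast

lemma A_change:
  assumes "x \<in> A" "y \<in> A" "P x" "\<not> P y"
  obtains u v where "u \<in> A" "v \<in> A" "u \<frown> v" "P u" "\<not> P v"
  using A_cut[of "{u \<in> A. P u}"] assms by auto

lemma A_edge:
  assumes "x \<in> A" "A \<noteq> {x}"
  obtains y where "y \<in> A" "x \<frown> y"
  using A_cut[of "{x}"] assms by auto

lemma describable_small_S: "card S \<le> k \<Longrightarrow> S \<in> describable k G"
  using S_sub by (auto simp: describable_def)

lemma describable_small_A: "card A \<le> k \<Longrightarrow> S \<in> describable k G"
  using A_sub S_eq_nbhd by (auto simp: describable_def)

lemma describable_attach:
  assumes "{p, p'} \<subseteq> A" "{q, q'} \<subseteq> B" "S \<subseteq> nbhd G {p, p'}" "S \<subseteq> nbhd G {q, q'}"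
  shows "S \<in> describable k G"
proof -
  have "S = nbhd G {p, p'} \<inter> nbhd G {q, q'}"
  proof
    show "nbhd G {p, p'} \<inter> nbhd G {q, q'} \<subseteq> S"
      using assms(1,2) common_nbr_in_S unfolding nbhd_def by blast
  qed (use assms(3,4) in blast)
  moreover have "{p, p', q, q'} \<subseteq> verts G"
    using assms A_sub B_sub by auto
  ultimately show ?thesis unfolding describable_def by blast
qed

text \<open>
  If \<open>s\<close> had a non-neighbour in \<open>A\<close>, then an edge of \<open>A\<close> from a neighbour to a non-neighbour of \<open>s\<close>
  would extend, through \<open>s\<close> and into \<open>B\<close>, to an induced path. So \<open>S\<close> consists of the common
  neighbours of any \<open>a \<in> A\<close> and \<open>b \<in> B\<close>.
\<close>

lemma P4_free_complete:
  assumes "\<not> contains G P4_pat" "s \<in> S" "a \<in> A"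
  shows "s \<frown> a"
proof (rule ccontr)
  assume "\<not> s \<frown> a"
  moreover obtain a' where "a' \<in> A" "s \<frown> a'" using A_full assms(2) by auto
  ultimately obtain u v where uv: "u \<in> A" "v \<in> A" "u \<frown> v" "s \<frown> u" "\<not> s \<frown> v"
    using A_change[of a' a "\<lambda>x. s \<frown> x"] assms(3) by metis
  obtain b where "b \<in> B" "s \<frown> b" using B_full assms(2) by auto
  then show False
    using contains_P4I[OF simple, of b s u v] uv assms(1) not_edge_AB edge_commute by blast
qed

lemma P4_free_describable:
  assumes "\<not> contains G P4_pat"
  shows "S \<in> describable k G"
proof -
  obtain a b where ab: "a \<in> A" "b \<in> B" using A_nonempty B_nonempty by blast
  have "s \<frown> a" "s \<frown> b" if "s \<in> S" for s
    using P4_free_complete[OF assms that] full_components.P4_free_complete[OF swap assms that] ab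
    by auto
  then show ?thesis
    using ab A_disj B_disj edge_commute
    by (intro describable_attach[of a a b b]) (auto simp: nbhd_def)
qed

text \<open>
  An edge of \<open>A\<close> and an edge of \<open>B\<close> would form \<open>2P\<^sub>2\<close>, so one of the components is a single vertex.
\<close>

lemma two_K2_free_describable:
  assumes "\<not> contains G two_K2_pat" "1 \<le> k"
  shows "S \<in> describable k G"
proof -
  obtain a b where ab: "a \<in> A" "b \<in> B" using A_nonempty B_nonempty by blast
  show ?thesis
  proof (cases "A = {a} \<or> B = {b}")
    case True
    then show ?thesis
      using describable_small_A[of k] full_components.describable_small_A[OF swap, of k] assms(2)
      by auto
  next
    case False
    obtain a' where "a' \<in> A" "a \<frown> a'" using A_edge ab False by metis
    moreover obtain b' where "b' \<in> B" "b \<frown> b'"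
      using full_components.A_edge[OF swap] ab False by metis
    ultimately show ?thesis
      using contains_two_K2I[OF simple, of a a' b b'] assms(1) ab not_edge_AB by blast
  qed
qed

text \<open>
  A connected graph that is not complete contains an induced \<open>P\<^sub>3\<close>, and a vertex of \<open>B\<close> is not
  adjacent to any of its vertices. The next two lemmas use \<open>B\<close> in the same way.
\<close>

lemma P3_K1_free_clique:
  assumes "\<not> contains G P3_K1_pat"
  shows "is_clique G A"
proof (rule ccontr)
  assume "\<not> is_clique G A"
  then obtain x y where xy: "x \<in> A" "y \<in> A" "x \<noteq> y" "\<not> x \<frown> y" by (auto simp: is_clique_def)
  then obtain u v where uv: "u \<in> A" "v \<in> A" "u \<frown> v" "u = x \<or> x \<frown> u" "\<not> (v = x \<or> x \<frown> v)"
    using A_change[of x y "\<lambda>z. z = x \<or> x \<frown> z"] by blast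
  obtain b where b: "b \<in> B" using B_nonempty by blast
  then show False
    using contains_P3_K1I[OF simple, of x u v b] uv xy assms not_edge_AB B_sub by blast
qed

lemma co_diamond_free_clique:
  assumes "\<not> contains G co_diamond_pat" "b \<in> B" "B \<noteq> {b}"
  shows "is_clique G A"
proof (rule ccontr)
  assume "\<not> is_clique G A"
  then obtain x y where xy: "x \<in> A" "y \<in> A" "x \<noteq> y" "\<not> x \<frown> y" by (auto simp: is_clique_def)
  obtain b' where "b' \<in> B" "b \<frown> b'"
    using full_components.A_edge[OF swap] assms by metis
  then show False
    using contains_co_diamondI[OF simple, of b b' x y] xy assms not_edge_AB A_sub by blast
qed

lemma K3_K1_free_triangle_free: "\<not> contains G K3_K1_pat \<Longrightarrow> triangle_free G A"
  using contains_K3_K1I[OF simple] B_nonempty B_sub not_edge_AB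
  unfolding triangle_free_def by blast

text \<open>
  A triangle of \<open>A\<close> would dominate everything that can be reached from it, in particular vertices of
  \<open>B\<close>. Some \<open>s \<in> S\<close> is needed as the bridge between \<open>A\<close> and \<open>B\<close>.
\<close>

lemma paw_free_triangle_free:
  assumes paw: "\<not> contains G paw_pat" and S: "S \<noteq> {}"
  shows "triangle_free G A"
  unfolding triangle_free_def
proof (intro ballI notI)
  fix x y z assume xyz: "x \<in> A" "y \<in> A" "z \<in> A" "x \<frown> y \<and> y \<frown> z \<and> x \<frown> z"
  define D where "D v \<longleftrightarrow> v \<in> {x, y, z} \<or> v \<frown> x \<or> v \<frown> y \<or> v \<frown> z" for v
  have D: "D v" if "D u" "u \<frown> v" for u v
    using paw_free_triangle_dominates[OF simple paw, of x y z u v] xyz that by (auto simp: D_def)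
  have DA: "D a" if "a \<in> A" for a
    using A_change[of x a D] xyz(1) D that by (metis D_def insertI1)
  obtain s where s: "s \<in> S" using S by blast
  then obtain a b where "a \<in> A" "s \<frown> a" "b \<in> B" "s \<frown> b" using A_full B_full by metis
  then have "b \<in> B" "D b" using D DA edge_commute by blast+
  then show False using xyz not_edge_AB AB_disj by (auto simp: D_def)
qed

lemma clique_small:
  assumes "is_clique G A" "triangle_free G A \<or> \<not> contains G K4_pat"
  shows "card A \<le> 3"
proof (rule ccontr)
  assume "\<not> card A \<le> 3"
  then have "4 \<le> card A" by simp
  then obtain x y z w where xyzw: "{x, y, z, w} \<subseteq> A" "distinct [x, y, z, w]"
    using four_distinct by blast
  then have "x \<frown> y" "x \<frown> z" "x \<frown> w" "y \<frown> z" "y \<frown> w" "z \<frown> w"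
    using assms(1) by (auto simp: is_clique_def)
  then show False
    using assms(2) contains_K4I[OF simple, of x y z w] xyzw unfolding triangle_free_def by blast
qed

text \<open>
  If \<open>a, a' \<in> A\<close> had incomparable neighbourhoods in the clique \<open>S\<close>, a private neighbour of each would
  complete the edge \<open>aa'\<close> to an induced 4-cycle. So these neighbourhoods form a chain, and its largest
  member is all of \<open>S\<close>.
\<close>

lemma C4_free_clique_dominates:
  assumes C4: "\<not> contains G C4_pat" and A: "is_clique G A" and S: "is_clique G S"
  obtains a where "a \<in> A" "S \<subseteq> nbhd G {a}"
proof -
  define N where "N a = {s \<in> S. a \<frown> s}" for a
  have fin: "finite (N a)" for a
    using S_sub simple finite_subset[of "N a" "verts G"] by (auto simp: N_def simple_graph_def)
  obtain a where a: "a \<in> A" "\<And>x. x \<in> A \<Longrightarrow> card (N x) \<le> card (N a)"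
  proof -
    have "Max ((\<lambda>x. card (N x)) ` A) \<in> (\<lambda>x. card (N x)) ` A"
      using finite_A A_nonempty by (intro Max_in) auto
    then obtain a where a: "a \<in> A" "Max ((\<lambda>x. card (N x)) ` A) = card (N a)" by blast
    moreover have "card (N x) \<le> Max ((\<lambda>x. card (N x)) ` A)" if "x \<in> A" for x
      using that finite_A by (intro Max_ge) auto
    ultimately show ?thesis using that by metis
  qed
  have "a \<frown> s" if s: "s \<in> S" for s
  proof (rule ccontr)
    assume as: "\<not> a \<frown> s"
    obtain a' where a': "a' \<in> A" "s \<frown> a'" using A_full s by auto
    have "N a \<noteq> N a'" "card (N a') \<le> card (N a)"
      using as a' s edge_commute a(2) unfolding N_def by blast+
    then have "\<not> N a \<subseteq> N a'"
      using fin by (metis card_seteq)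
    then obtain t where t: "t \<in> S" "a \<frown> t" "\<not> a' \<frown> t" by (auto simp: N_def)
    have "a \<noteq> a'" "s \<noteq> t" using as a' t edge_commute by blast+
    then have "a \<frown> a'" "s \<frown> t" using A S a a' s t by (auto simp: is_clique_def)
    then show False
      using contains_C4I[OF simple, of t a a' s] C4 as a' t \<open>a \<noteq> a'\<close> edge_commute
      by (metis A_disj disjoint_iff a(1) s)
  qed
  then show ?thesis using a(1) that A_disj by (force simp: nbhd_def)
qed

end

definition leaf_in :: "'a graph \<Rightarrow> 'a set \<Rightarrow> 'a \<Rightarrow> bool" where
  "leaf_in G X x \<longleftrightarrow> (\<forall>y\<in>X. \<forall>z\<in>X. adjacent G x y \<and> adjacent G x z \<longrightarrow> y = z)"

context full_components
begin

text \<open>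
  If \<open>s, t \<in> S\<close> are non-adjacent and share no neighbour in \<open>A\<close>, then \<open>A\<close> splits, up to one
  vertex \<open>c\<close>, into the neighbours of \<open>s\<close> and those of \<open>t\<close>. A common neighbour \<open>v \<in> S\<close> of \<open>s\<close> and
  \<open>t\<close> that misses \<open>a\<close> and \<open>c\<close> would, through a neighbour in \<open>A\<close>, close an induced 4-cycle. Hence
  the common neighbours of \<open>s\<close> and \<open>t\<close> that miss \<open>a\<close> and \<open>c\<close> lie in \<open>B\<close>.
\<close>

lemma nonadjacent_pair_describable:
  assumes C4: "\<not> contains G C4_pat" and A: "is_clique G A"
    and st: "s \<in> S" "t \<in> S" "\<not> s \<frown> t"
    and no_common: "\<And>x. x \<in> A \<Longrightarrow> s \<frown> x \<Longrightarrow> t \<frown> x \<Longrightarrow> False"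
    and a: "a \<in> A" "s \<frown> a"
    and c: "c \<in> A" "\<And>x. x \<in> A \<Longrightarrow> \<not> s \<frown> x \<Longrightarrow> \<not> t \<frown> x \<Longrightarrow> x = c"
    and b: "{b, b'} \<subseteq> B" "\<And>y. y \<in> B \<Longrightarrow> y \<notin> {b, b'} \<Longrightarrow> s \<frown> y \<and> t \<frown> y"
    and outside: "\<And>v. s \<frown> v \<Longrightarrow> t \<frown> v \<Longrightarrow> v \<in> A \<union> B \<union> S"
  shows "S \<in> describable k G"
proof -
  have "private_common_nbrs G s t a c \<subseteq> B"
  proof
    fix v assume "v \<in> private_common_nbrs G s t a c"
    then have v: "s \<frown> v" "t \<frown> v" "\<not> a \<frown> v" "\<not> c \<frown> v" by (auto simp: private_common_nbrs_def)
    have False if vS: "v \<in> S"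
    proof -
      obtain x where x: "x \<in> A" "v \<frown> x" using A_full[OF vS] by blast
      obtain y where y: "y \<in> A" "t \<frown> y" using A_full[OF st(2)] by blast
      \<comment> \<open>Otherwise \<open>v, z, a, s\<close> is an induced 4-cycle.\<close>
      have not_t: False if z: "z \<in> A" "v \<frown> z" "t \<frown> z" for z
      proof -
        have "z \<noteq> a" "\<not> s \<frown> z" using z a no_common by blast+
        moreover have "z \<noteq> s" using z st A_disj by blast
        moreover have "v \<noteq> a" using vS a A_disj by blast
        ultimately show False
          using contains_C4I[OF simple, of v z a s] C4 A z v a edge_commute
          unfolding is_clique_def by blast
      qed
      have "\<not> t \<frown> x" using not_t x by blast
      moreover have "x \<noteq> c" using v x edge_commute by blast
      ultimately have "s \<frown> x" using c x by blast
      moreover have "\<not> v \<frown> y" using not_t y by blast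
      moreover have "x \<noteq> y" using \<open>\<not> t \<frown> x\<close> y by blast
      \<comment> \<open>Now \<open>v, x, y, t\<close> is an induced 4-cycle.\<close>
      moreover have "x \<noteq> t" "v \<noteq> y" using x st vS y A_disj by blast+
      ultimately show False
        using contains_C4I[OF simple, of v x y t] C4 A x y v \<open>\<not> t \<frown> x\<close> edge_commute
        unfolding is_clique_def by blast
    qed
    then show "v \<in> B" using outside[of v] v no_common by blast
  qed
  moreover have "B \<subseteq> private_common_nbrs G s t a c \<union> {b, b'}"
    using b(2) a c not_edge_AB unfolding private_common_nbrs_def by blast
  ultimately have "B = private_common_nbrs G s t a c \<union> {b, b'}"
    using b(1) by blast
  then have "S = nbhd G (private_common_nbrs G s t a c \<union> {b, b'})"
    using full_components.S_eq_nbhd[OF swap] by simp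
  moreover have "{s, t, a, c, b, b'} \<subseteq> verts G"
    using st a c b A_sub B_sub S_sub by blast
  ultimately show ?thesis unfolding describable_def by blast
qed

text \<open>
  An edge together with two non-adjacent vertices that it misses is forbidden. Therefore at most one
  vertex of \<open>A\<close> is missed by both \<open>s\<close> and \<open>t\<close>, each of \<open>s\<close> and \<open>t\<close> misses at most one vertex of \<open>B\<close>,
  and there is no third component.
\<close>

lemma nonadjacent_pair_describable_co_diamond_free:
  assumes C4: "\<not> contains G C4_pat" and cd: "\<not> contains G co_diamond_pat"
    and A: "is_clique G A" and B: "is_clique G B"
    and st: "s \<in> S" "t \<in> S" "s \<noteq> t" "\<not> s \<frown> t"
    and no_common: "\<And>x. x \<in> A \<Longrightarrow> s \<frown> x \<Longrightarrow> t \<frown> x \<Longrightarrow> False"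
  shows "S \<in> describable k G"
proof -
  have stV: "s \<in> verts G" "t \<in> verts G" using st S_sub by auto
  obtain a where a: "a \<in> A" "s \<frown> a" using A_full st by blast
  obtain y where y: "y \<in> A" "t \<frown> y" using A_full st by blast
  have ay': "\<not> s \<frown> y" "\<not> t \<frown> a" using a y no_common by blast+
  then have "a \<noteq> y" using y by metis
  then have "a \<frown> y" using A a y by (auto simp: is_clique_def)
  note ay = this ay'
  have "x = z" if "x \<in> A" "z \<in> A" "\<not> s \<frown> x" "\<not> t \<frown> x" "\<not> s \<frown> z" "\<not> t \<frown> z" for x z
    using contains_co_diamondI[OF simple, of x z s t] cd A that st stV edge_commute
    unfolding is_clique_def by blast
  then obtain c where c: "c \<in> A" "\<And>x. x \<in> A \<Longrightarrow> \<not> s \<frown> x \<Longrightarrow> \<not> t \<frown> x \<Longrightarrow> x = c"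
    using a(1) by metis
  have one_missing: "\<exists>b\<in>B. \<forall>x\<in>B. \<not> u \<frown> x \<longrightarrow> x = b"
    if u: "u \<in> S" "z \<in> A" "\<not> u \<frown> z" for u z
  proof -
    have "x = x'" if "x \<in> B" "x' \<in> B" "\<not> u \<frown> x" "\<not> u \<frown> x'" for x x'
    proof -
      have "u \<noteq> z" "u \<in> verts G" "z \<in> verts G" using u A_disj S_sub A_sub by blast+
      then show ?thesis
        using contains_co_diamondI[OF simple, of x x' u z] cd B that u not_edge_AB edge_commute
        unfolding is_clique_def by blast
    qed
    then show ?thesis using B_nonempty by blast
  qed
  obtain b where b: "b \<in> B" "\<And>x. x \<in> B \<Longrightarrow> \<not> s \<frown> x \<Longrightarrow> x = b"
    using one_missing[OF st(1) y(1) ay(2)] by blast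
  obtain b' where b': "b' \<in> B" "\<And>x. x \<in> B \<Longrightarrow> \<not> t \<frown> x \<Longrightarrow> x = b'"
    using one_missing[OF st(2) a(1) ay(3)] by blast
  show ?thesis
  proof (rule nonadjacent_pair_describable[where b = b and b' = b', OF C4 A st(1,2,4) no_common a c])
    fix v assume v: "s \<frown> v" "t \<frown> v"
    show "v \<in> A \<union> B \<union> S"
    proof (rule ccontr)
      assume "v \<notin> A \<union> B \<union> S"
      then have "v \<noteq> b" "\<not> a \<frown> v" "\<not> y \<frown> v" "\<not> v \<frown> b"
        using A_closed[OF a(1), of v] A_closed[OF y(1), of v] B_closed[OF b(1), of v] b(1)
          edge_commute[of v b] by blast+
      then show False
        using contains_co_diamondI[OF simple, of a y v b] cd ay(1) a(1) y(1) b(1) not_edge_AB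
          adjacentD(2)[OF simple v(1)] B_sub by blast
    qed
  next
    show "{b, b'} \<subseteq> B" using b(1) b'(1) by simp
    show "s \<frown> x \<and> t \<frown> x" if "x \<in> B" "x \<notin> {b, b'}" for x
      using b(2) b'(2) that by blast
  qed
qed

text \<open>
  Each of \<open>s\<close>, \<open>t\<close> misses a vertex of \<open>A\<close>, which forces it to be complete to \<open>B\<close>. Then \<open>s\<close>, a vertex
  of \<open>B\<close> and \<open>t\<close> form a \<open>P\<^sub>3\<close>, so every vertex of \<open>A\<close> is adjacent to \<open>s\<close> or \<open>t\<close>.
\<close>

lemma nonadjacent_pair_describable_P3_K1_free:
  assumes C4: "\<not> contains G C4_pat" and P3: "\<not> contains G P3_K1_pat"
    and st: "s \<in> S" "t \<in> S" "s \<noteq> t" "\<not> s \<frown> t"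
    and no_common: "\<And>x. x \<in> A \<Longrightarrow> s \<frown> x \<Longrightarrow> t \<frown> x \<Longrightarrow> False"
  shows "S \<in> describable k G"
proof -
  have A: "is_clique G A" and B: "is_clique G B"
    using P3_K1_free_clique full_components.P3_K1_free_clique[OF swap] P3 by auto
  obtain a where a: "a \<in> A" "s \<frown> a" using A_full st by blast
  obtain y where y: "y \<in> A" "t \<frown> y" using A_full st by blast
  have ay': "\<not> s \<frown> y" "\<not> t \<frown> a" using a y no_common by blast+
  then have "a \<noteq> y" using y by metis
  then have "a \<frown> y" using A a y by (auto simp: is_clique_def)
  note ay = this ay'
  obtain b where b: "b \<in> B" using B_nonempty by blast
  have complete: "u \<frown> x" if u: "u \<in> S" "x \<in> B" "z \<in> A" "\<not> u \<frown> z" for u x z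
  proof (rule ccontr)
    assume no: "\<not> u \<frown> x"
    obtain x' where x': "x' \<in> B" "u \<frown> x'" using B_full u by blast
    have "x \<noteq> x'" using no x' by blast
    then have "x \<frown> x'" using B u x' by (auto simp: is_clique_def)
    moreover have "x' \<frown> u" "\<not> x \<frown> u" using no x' edge_commute by blast+
    moreover have "x \<noteq> u" "z \<in> verts G" using u B_disj A_sub by blast+
    ultimately show False
      using contains_P3_K1I[OF simple, of x x' u z] P3 u x' not_edge_AB by blast
  qed
  have sb: "s \<frown> x" "t \<frown> x" if "x \<in> B" for x
    using complete that st a(1) y(1) ay by blast+
  have split: "s \<frown> x \<or> t \<frown> x" if "x \<in> A" for x
    using contains_P3_K1I[OF simple, of s b t x] P3 sb[OF b] b st that not_edge_AB A_sub edge_commute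
    by blast
  show ?thesis
  proof (rule nonadjacent_pair_describable[where b = b and b' = b, OF C4 A st(1,2,4) no_common a a(1)])
    fix v assume v: "s \<frown> v" "t \<frown> v"
    show "v \<in> A \<union> B \<union> S"
    proof (rule ccontr)
      assume "v \<notin> A \<union> B \<union> S"
      then have "v \<noteq> b" "\<not> v \<frown> b"
        using B_closed[OF b, of v] b edge_commute[of v b] by blast+
      then show False
        using contains_C4I[OF simple, of s b t v] C4 sb[OF b] st v edge_commute[of b]
          edge_commute[of v] by blast
    qed
  next
    show "{b, b} \<subseteq> B" using b by simp
    show "s \<frown> x \<and> t \<frown> x" if "x \<in> B" for x using sb that by blast
    show "x = a" if "x \<in> A" "\<not> s \<frown> x" "\<not> t \<frown> x" for x using split that by blast
  qed
qed

text \<open>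
  Two non-adjacent vertices of \<open>S\<close> cannot have common neighbours both in \<open>A\<close> and in \<open>B\<close>, as these
  four vertices would induce a 4-cycle; so the preceding lemmas apply to \<open>A\<close> or, by symmetry, to \<open>B\<close>.
\<close>

lemma C4_free_cliques_describable:
  assumes C4: "\<not> contains G C4_pat" and A: "is_clique G A" and B: "is_clique G B"
    and sparse: "\<not> contains G co_diamond_pat \<or> \<not> contains G P3_K1_pat"
  shows "S \<in> describable k G"
proof (cases "is_clique G S")
  case True
  obtain a where "a \<in> A" "S \<subseteq> nbhd G {a}"
    using C4_free_clique_dominates[OF C4 A True] by blast
  moreover obtain b where "b \<in> B" "S \<subseteq> nbhd G {b}"
    using full_components.C4_free_clique_dominates[OF swap C4 B True] by blast
  ultimately show ?thesis by (intro describable_attach[of a a b b]) auto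
next
  case False
  then obtain s t where st: "s \<in> S" "t \<in> S" "s \<noteq> t" "\<not> s \<frown> t" by (auto simp: is_clique_def)
  have "False" if "x \<in> A" "y \<in> B" "s \<frown> x" "t \<frown> x" "s \<frown> y" "t \<frown> y" for x y
  proof -
    have "x \<noteq> y" using that AB_disj by blast
    then show False
      using contains_C4I[OF simple, of s x t y] C4 that st not_edge_AB edge_commute by blast
  qed
  then consider "\<And>x. x \<in> A \<Longrightarrow> s \<frown> x \<Longrightarrow> t \<frown> x \<Longrightarrow> False" | "\<And>x. x \<in> B \<Longrightarrow> s \<frown> x \<Longrightarrow> t \<frown> x \<Longrightarrow> False"
    by metis
  then show ?thesis
  proof cases
    case 1
    then show ?thesis
      using sparse nonadjacent_pair_describable_co_diamond_free[OF C4 _ A B st]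
        nonadjacent_pair_describable_P3_K1_free[OF C4 _ st] by blast
  next
    case 2
    then show ?thesis
      using sparse
        full_components.nonadjacent_pair_describable_co_diamond_free[OF swap C4 _ B A st]
        full_components.nonadjacent_pair_describable_P3_K1_free[OF swap C4 _ st] by blast
  qed
qed

text \<open>
  Unless one of the components is a single vertex, both are cliques, and they are bounded in size
  except in the \<open>C\<^sub>4\<close>-free case.
\<close>

lemma sparse_describable:
  assumes sparse: "\<not> contains G co_diamond_pat \<or> \<not> contains G P3_K1_pat"
    and dense: "\<not> contains G K3_K1_pat \<or> \<not> contains G paw_pat \<or> \<not> contains G K4_pat \<or>
      \<not> contains G C4_pat"
    and k: "3 \<le> k"
  shows "S \<in> describable k G"
proof (cases "S = {} \<or> (\<exists>a. A = {a}) \<or> (\<exists>b. B = {b})")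
  case True
  then have "card S \<le> k \<or> card A \<le> k \<or> card B \<le> k" using k by auto
  then show ?thesis
    using describable_small_S describable_small_A full_components.describable_small_A[OF swap]
    by blast
next
  case False
  obtain a b where "a \<in> A" "b \<in> B" using A_nonempty B_nonempty by blast
  then have A: "is_clique G A" and B: "is_clique G B"
    using sparse False P3_K1_free_clique full_components.P3_K1_free_clique[OF swap]
      co_diamond_free_clique[of b] full_components.co_diamond_free_clique[OF swap, of a] by auto
  show ?thesis
  proof (cases "contains G C4_pat")
    case True
    then have "triangle_free G A \<or> \<not> contains G K4_pat"
      using dense False K3_K1_free_triangle_free paw_free_triangle_free by auto
    then show ?thesis using clique_small[OF A] describable_small_A k by force
  next
    case False
    then show ?thesis using C4_free_cliques_describable A B sparse by blast
  qed
qed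

text \<open>
  In a \<open>K\<^sub>4\<close> inside \<open>S\<close>, private neighbours in \<open>A\<close> of the four vertices are pairwise non-adjacent,
  because two adjacent ones would close an induced 4-cycle.
\<close>

lemma private_nbrs_four_K1:
  assumes C4: "\<not> contains G C4_pat" and K: "{x, y, z, w} \<subseteq> S" "distinct [x, y, z, w]"
    and clique: "is_clique G {x, y, z, w}"
    and one_nbr: "\<And>a p q. a \<in> A \<Longrightarrow> {p, q} \<subseteq> {x, y, z, w} \<Longrightarrow> a \<frown> p \<Longrightarrow> a \<frown> q \<Longrightarrow> p = q"
  shows "contains G four_K1_pat"
proof -
  define K where "K = {x, y, z, w}"
  have "\<exists>a\<in>A. a \<frown> p" if "p \<in> K" for p
    using A_full[of p] K(1) edge_commute[of p] that unfolding K_def by blast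
  then obtain f where f: "\<And>p. p \<in> K \<Longrightarrow> f p \<in> A" "\<And>p. p \<in> K \<Longrightarrow> f p \<frown> p" by metis
  have *: "f p \<noteq> f q \<and> \<not> f p \<frown> f q" if pq: "p \<in> K" "q \<in> K" "p \<noteq> q" for p q
  proof -
    have "\<not> f p \<frown> q" "\<not> f q \<frown> p"
      using one_nbr[of "f p" p q] one_nbr[of "f q" q p] f(1,2)[OF pq(1)] f(1,2)[OF pq(2)] pq
      unfolding K_def by blast+
    moreover have "p \<frown> q" using clique pq unfolding is_clique_def K_def by blast
    moreover have "p \<noteq> f q" "q \<noteq> f p"
      using f(1)[OF pq(1)] f(1)[OF pq(2)] pq K(1) A_disj unfolding K_def by blast+
    ultimately show ?thesis
      using contains_C4I[OF simple, of p q "f q" "f p"] C4 f(2)[OF pq(1)] f(2)[OF pq(2)] edge_commute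
      by metis
  qed
  have "{f x, f y, f z, f w} \<subseteq> verts G" using f A_sub unfolding K_def by blast
  then show ?thesis
    using K(2) * unfolding K_def by (intro contains_four_K1I[OF simple, of "f x" "f y" "f z" "f w"]) auto
qed

text \<open>
  Without private neighbours in \<open>A\<close>, some \<open>a \<in> A\<close> sees two vertices of the \<open>K\<^sub>4\<close>, and then all of
  it, since there are no diamonds. The same holds for some \<open>b \<in> B\<close>; but \<open>a\<close>, \<open>b\<close> and two vertices of the
  \<open>K\<^sub>4\<close> form a diamond.
\<close>

lemma no_K4_in_separator:
  assumes C4: "\<not> contains G C4_pat" and dia: "\<not> contains G diamond_pat"
    and four: "\<not> contains G four_K1_pat"
    and K: "{x, y, z, w} \<subseteq> S" "distinct [x, y, z, w]" "is_clique G {x, y, z, w}"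
  shows False
proof -
  define K where "K = {x, y, z, w}"
  have pK: "p \<frown> q" if "p \<in> K" "q \<in> K" "p \<noteq> q" for p q
    using that K(3) by (auto simp: is_clique_def K_def)
  have complete: "v \<frown> r" if v: "v \<notin> S" "p \<in> K" "q \<in> K" "p \<noteq> q" "v \<frown> p" "v \<frown> q" "r \<in> K" for v p q r
  proof (rule ccontr)
    assume "\<not> v \<frown> r"
    moreover have "v \<noteq> r" using v K(1) by (auto simp: K_def)
    moreover have "r \<noteq> p" "r \<noteq> q" using v \<open>\<not> v \<frown> r\<close> by blast+
    ultimately show False
      using contains_diamondI[OF simple, of v r p q] dia v pK by blast
  qed
  have "\<exists>a\<in>A. \<exists>p\<in>K. \<exists>q\<in>K. p \<noteq> q \<and> a \<frown> p \<and> a \<frown> q"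
  proof (rule ccontr)
    assume no: "\<not> ?thesis"
    have "contains G four_K1_pat"
      by (rule private_nbrs_four_K1[OF C4 K]) (use no in \<open>auto simp: K_def\<close>)
    then show False using four by simp
  qed
  then obtain a p q where a: "a \<in> A" "p \<in> K" "q \<in> K" "p \<noteq> q" "a \<frown> p" "a \<frown> q" by blast
  have "\<exists>b\<in>B. \<exists>p\<in>K. \<exists>q\<in>K. p \<noteq> q \<and> b \<frown> p \<and> b \<frown> q"
  proof (rule ccontr)
    assume no: "\<not> ?thesis"
    have "contains G four_K1_pat"
      by (rule full_components.private_nbrs_four_K1[OF swap C4 K])
        (use no in \<open>auto simp: K_def\<close>)
    then show False using four by simp
  qed
  then obtain b p' q' where b: "b \<in> B" "p' \<in> K" "q' \<in> K" "p' \<noteq> q'" "b \<frown> p'" "b \<frown> q'"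
    by blast
  have "b \<frown> p" "b \<frown> q" using complete[of b p' q'] a b B_disj by blast+
  then show False
    using contains_diamondI[OF simple, of a b p q] dia a b pK not_edge_AB AB_disj by blast
qed

text \<open>
  By Ramsey's theorem a vertex set without four independent vertices is bounded once its cliques are;
  this is applied to \<open>A\<close> if it has no triangle, and to \<open>S\<close> otherwise.
\<close>

lemma four_K1_free_describable:
  assumes r: "ramsey_4_4 TYPE('a) r" "r \<le> k" and four: "\<not> contains G four_K1_pat"
    and dense: "\<not> contains G K3_K1_pat \<or> \<not> contains G paw_pat \<or> \<not> contains G K4_pat \<or>
      \<not> contains G C4_pat \<and> \<not> contains G diamond_pat"
  shows "S \<in> describable k G"
proof (cases "S = {}")
  case True
  then show ?thesis using describable_small_S[of k] by auto
next
  case False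
  consider "triangle_free G A" | "\<not> contains G K4_pat" | "\<not> contains G C4_pat" "\<not> contains G diamond_pat"
    using dense False K3_K1_free_triangle_free paw_free_triangle_free by blast
  then show ?thesis
  proof cases
    case 1
    have "card A \<le> r"
    proof (rule ramsey_bound[OF simple A_sub r(1) four])
      fix x y z w assume "{x, y, z, w} \<subseteq> A" "distinct [x, y, z, w]" "is_clique G {x, y, z, w}"
      then show False using 1 by (auto simp: triangle_free_def is_clique_def)
    qed
    then show ?thesis using describable_small_A r(2) by simp
  next
    case 2
    have "card S \<le> r"
    proof (rule ramsey_bound[OF simple S_sub r(1) four])
      fix x y z w assume "distinct [x, y, z, w]" "is_clique G {x, y, z, w}"
      then show False
        using 2 contains_K4I[OF simple, of x y z w] by (auto simp: is_clique_def)
    qed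
    then show ?thesis using describable_small_S r(2) by simp
  next
    case 3
    have "card S \<le> r"
      using ramsey_bound[OF simple S_sub r(1) four no_K4_in_separator[OF 3 four]] .
    then show ?thesis using describable_small_S r(2) by simp
  qed
qed

text \<open>
  A claw-free \<open>A\<close> without triangles is a path or a cycle, so it has at most two vertices of degree
  at most one. To find them, grow a path from one such vertex \<open>p\<close>: all its vertices but the last
  one, \<open>q\<close>, have all their neighbours on it.
\<close>

lemma two_ends:
  assumes deg: "\<And>x y1 y2 y3. {x, y1, y2, y3} \<subseteq> A \<Longrightarrow> distinct [y1, y2, y3] \<Longrightarrow>
      x \<frown> y1 \<Longrightarrow> x \<frown> y2 \<Longrightarrow> x \<frown> y3 \<Longrightarrow> False"
    and p: "p \<in> A" "leaf_in G A p"
  shows "\<exists>q\<in>A. \<forall>x\<in>A. leaf_in G A x \<longrightarrow> x = p \<or> x = q"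
proof -
  \<comment> \<open>\<open>X\<close> is the part grown so far and \<open>q\<close> its last vertex.\<close>
  define arm where "arm X q \<longleftrightarrow> X \<subseteq> A \<and> p \<in> X \<and> q \<in> X \<and>
    (\<forall>x\<in>X - {q}. \<forall>y\<in>A. x \<frown> y \<longrightarrow> y \<in> X) \<and> (\<forall>x\<in>X - {p, q}. \<not> leaf_in G A x) \<and>
    (q \<noteq> p \<longrightarrow> (\<exists>z\<in>X. q \<frown> z))" for X q
  have "arm {p} p" using p by (auto simp: arm_def)
  then have ex: "\<exists>q. arm {p} q" by blast
  have bound: "\<forall>X. (\<exists>q. arm X q) \<longrightarrow> card X < Suc (card A)"
    using card_mono[OF finite_A] unfolding arm_def less_Suc_eq_le by blast
  obtain X where max': "(\<exists>q. arm X q) \<and> (\<forall>Y. (\<exists>q. arm Y q) \<longrightarrow> card Y \<le> card X)"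
    using ex_has_greatest_nat[of "\<lambda>X. \<exists>q. arm X q" "{p}" card "Suc (card A)", OF ex bound] by (rule exE)
  then obtain q where X: "arm X q" by (elim conjE exE)
  have max: "card Y \<le> card X" if "arm Y q'" for Y q'
    using max'[THEN conjunct2, rule_format, OF exI, OF that] .
  have XA: "X \<subseteq> A" "p \<in> X" "q \<in> X" using X unfolding arm_def by blast+
  then have fin: "finite X" using finite_A finite_subset by blast
  have q_nbr: "\<exists>z\<in>X. q \<frown> z" if "q \<noteq> p" using X that unfolding arm_def by blast
  have "y \<in> X" if y: "y \<in> A" "q \<frown> y" for y
  proof (rule ccontr)
    assume yX: "y \<notin> X"
    have q_nbrs: "u \<in> insert y X" if u: "u \<in> A" "q \<frown> u" for u
    proof (cases "q = p")
      case True
      then show ?thesis using p(2) u y unfolding leaf_in_def by blast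
    next
      case False
      then obtain z where z: "z \<in> X" "q \<frown> z" using q_nbr by blast
      show ?thesis
      proof (rule ccontr)
        assume "u \<notin> insert y X"
        then have "distinct [y, z, u]" "{q, y, z, u} \<subseteq> A" using yX z u y XA by auto
        then show False using deg y(2) z(2) u(2) by blast
      qed
    qed
    have q_leaf: "\<not> leaf_in G A q" if qp: "q \<noteq> p"
    proof -
      obtain z where "z \<in> X" "q \<frown> z" using q_nbr[OF qp] by blast
      then show ?thesis using y yX XA unfolding leaf_in_def by blast
    qed
    have yq: "y \<frown> q" using y(2) edge_commute[of q] by blast
    have "arm (insert y X) y"
      unfolding arm_def
    proof (intro conjI ballI impI)
      fix x u assume "x \<in> insert y X - {y}" "u \<in> A" "x \<frown> u"
      then show "u \<in> insert y X" using X q_nbrs unfolding arm_def by (cases "x = q") blast+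
    next
      fix x assume "x \<in> insert y X - {p, y}"
      then show "\<not> leaf_in G A x" using X q_leaf unfolding arm_def by (cases "x = q") blast+
    next
      show "\<exists>z\<in>insert y X. y \<frown> z" using yq XA by blast
    qed (use XA y(1) in auto)
    then have "card (insert y X) \<le> card X" by (rule max)
    then show False using yX fin by simp
  qed
  then have closed: "y \<in> X" if "x \<in> X" "y \<in> A" "x \<frown> y" for x y
    using X that unfolding arm_def by blast
  then have "X = A"
    using A_cut[of X] XA by blast
  then have "q \<in> A" "\<forall>x\<in>A - {p, q}. \<not> leaf_in G A x" using X unfolding arm_def by simp_all
  then show ?thesis by blast
qed

text \<open>
  The neighbour \<open>x \<in> A\<close> of a vertex \<open>s \<in> S\<close> is an end of \<open>A\<close>: two neighbours of \<open>x\<close> in \<open>A\<close> would,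
  together with \<open>s\<close>, be the leaves of a claw with centre \<open>x\<close>.
\<close>

lemma claw_free_attach:
  assumes claw: "\<not> contains G claw_pat" and tf: "triangle_free G A"
    and single: "\<And>s x y. s \<in> S \<Longrightarrow> {x, y} \<subseteq> A \<Longrightarrow> s \<frown> x \<Longrightarrow> s \<frown> y \<Longrightarrow> x = y"
  obtains p q where "{p, q} \<subseteq> A" "S \<subseteq> nbhd G {p, q}"
proof (cases "S = {}")
  case True
  then show ?thesis using that A_nonempty by blast
next
  case False
  have leaf: "leaf_in G A x" if x: "s \<in> S" "x \<in> A" "s \<frown> x" for s x
    unfolding leaf_in_def
  proof (intro ballI impI, rule ccontr)
    fix y z assume yz: "y \<in> A" "z \<in> A" "x \<frown> y \<and> x \<frown> z" "y \<noteq> z"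
    have "\<not> y \<frown> z" using tf x yz unfolding triangle_free_def by blast
    moreover have "y \<noteq> x" "z \<noteq> x" using yz adjacentD(3)[OF simple] by blast+
    then have "\<not> s \<frown> y" "\<not> s \<frown> z" using single[OF x(1)] x yz by blast+
    moreover have "s \<noteq> y" "s \<noteq> z" using x yz A_disj by blast+
    ultimately show False
      using contains_clawI[OF simple, of x s y z] claw x yz edge_commute by auto
  qed
  have deg: False if "{x, y1, y2, y3} \<subseteq> A" "distinct [y1, y2, y3]" "x \<frown> y1" "x \<frown> y2" "x \<frown> y3"
    for x y1 y2 y3
    using contains_clawI[OF simple, of x y1 y2 y3] claw tf that unfolding triangle_free_def by blast
  obtain s p where s: "s \<in> S" "p \<in> A" "s \<frown> p" using False A_full by blast
  have "\<exists>q\<in>A. \<forall>x\<in>A. leaf_in G A x \<longrightarrow> x = p \<or> x = q"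
    by (rule two_ends[OF _ s(2) leaf[OF s]]) (rule deg)
  then obtain q where q: "q \<in> A" "\<And>x. x \<in> A \<Longrightarrow> leaf_in G A x \<Longrightarrow> x = p \<or> x = q" by blast
  have "S \<subseteq> nbhd G {p, q}"
  proof
    fix t assume t: "t \<in> S"
    then obtain x where x: "x \<in> A" "t \<frown> x" using A_full by blast
    then have "x \<in> {p, q}" using q(2)[of x] leaf[OF t] by blast
    moreover have "x \<frown> t" using x edge_commute[of t] by blast
    moreover have "t \<notin> {p, q}" using t s(2) q(1) A_disj by blast
    ultimately show "t \<in> nbhd G {p, q}" unfolding nbhd_def by blast
  qed
  then show ?thesis using that s q by blast
qed

text \<open>
  Two neighbours of \<open>s\<close> in \<open>A\<close> must be adjacent, since a neighbour of \<open>s\<close> in \<open>B\<close> would complete them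
  to a claw. The triangle so obtained has a pendant edge into \<open>B\<close>, so it is
  \<open>K\<^sub>3 + P\<^sub>1\<close> that is forbidden, which makes \<open>s\<close> complete to \<open>B\<close> and \<open>B\<close> a small clique.
\<close>

lemma two_attachments_small_side:
  assumes claw: "\<not> contains G claw_pat" and dense: "\<not> contains G K3_K1_pat \<or> \<not> contains G paw_pat"
    and tf: "triangle_free G B"
    and s: "s \<in> S" "{x, y} \<subseteq> A" "s \<frown> x" "s \<frown> y" "x \<noteq> y"
  shows "card B \<le> 3"
proof -
  obtain b where b: "b \<in> B" "s \<frown> b" using B_full s(1) by blast
  have "b \<noteq> x" "b \<noteq> y" using b s AB_disj by blast+
  then have xy: "x \<frown> y"
    using contains_clawI[OF simple, of s x y b] claw s b not_edge_AB(1)[of x b]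
      not_edge_AB(1)[of y b] by auto
  have "contains G paw_pat"
    using contains_pawI[OF simple, of x y s b] xy s b not_edge_AB(1)[of x b]
      not_edge_AB(1)[of y b] edge_commute[of s] by blast
  then have "\<not> contains G K3_K1_pat" using dense by blast
  then have all: "s \<frown> u" if "u \<in> B" for u
    using contains_K3_K1I[OF simple, of x y s u] \<open>\<not> contains G K3_K1_pat\<close> xy s that
      not_edge_AB(1)[of x u] not_edge_AB(1)[of y u] edge_commute[of s] B_sub by blast
  have "is_clique G B"
    unfolding is_clique_def
  proof (intro ballI impI, rule ccontr)
    fix u v assume uv: "u \<in> B" "v \<in> B" "u \<noteq> v" "\<not> u \<frown> v"
    have "x \<noteq> u" "x \<noteq> v" using uv s AB_disj by blast+
    then show False
      using contains_clawI[OF simple, of s x u v] claw s uv all[of u] all[of v]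
        not_edge_AB(1)[of x u] not_edge_AB(1)[of x v] by auto
  qed
  then show ?thesis
    using full_components.clique_small[OF swap] tf by blast
qed

lemma claw_free_describable:
  assumes claw: "\<not> contains G claw_pat" and dense: "\<not> contains G K3_K1_pat \<or> \<not> contains G paw_pat"
    and k: "3 \<le> k"
  shows "S \<in> describable k G"
proof (cases "S = {} \<or> card A \<le> 3 \<or> card B \<le> 3")
  case True
  then have "card S \<le> k \<or> card A \<le> k \<or> card B \<le> k" using k by auto
  then show ?thesis
    using describable_small_S describable_small_A full_components.describable_small_A[OF swap]
    by blast
next
  case False
  have A: "triangle_free G A"
    using dense False K3_K1_free_triangle_free paw_free_triangle_free by blast
  have B: "triangle_free G B"
    using dense False full_components.K3_K1_free_triangle_free[OF swap]
      full_components.paw_free_triangle_free[OF swap] by blast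
  obtain p p' where "{p, p'} \<subseteq> A" "S \<subseteq> nbhd G {p, p'}"
  proof (rule claw_free_attach[OF claw A])
    show "x = y" if "s \<in> S" "{x, y} \<subseteq> A" "s \<frown> x" "s \<frown> y" for s x y
      using two_attachments_small_side[OF claw dense B that] False by blast
  qed
  moreover obtain q q' where "{q, q'} \<subseteq> B" "S \<subseteq> nbhd G {q, q'}"
  proof (rule full_components.claw_free_attach[OF swap claw B])
    show "x = y" if "s \<in> S" "{x, y} \<subseteq> B" "s \<frown> x" "s \<frown> y" for s x y
      using full_components.two_attachments_small_side[OF swap claw dense A that] False by blast
  qed
  ultimately show ?thesis using describable_attach[of p p' q q'] by blast
qed

end

section \<open>Induced subgraphs as embeddings\<close>

definition embeds :: "'a graph \<Rightarrow> 'b graph \<Rightarrow> bool" where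
  "embeds H G \<longleftrightarrow> (\<exists>f. inj_on f (verts H) \<and> f ` verts H \<subseteq> verts G \<and>
     (\<forall>u\<in>verts H. \<forall>v\<in>verts H. adjacent H u v \<longleftrightarrow> adjacent G (f u) (f v)))"

lemma embeds_trans:
  assumes "embeds F H" "embeds H G"
  shows "embeds F G"
proof -
  obtain f where f: "inj_on f (verts F)" "f ` verts F \<subseteq> verts H"
    "\<forall>u\<in>verts F. \<forall>v\<in>verts F. adjacent F u v \<longleftrightarrow> adjacent H (f u) (f v)"
    using assms(1) unfolding embeds_def by blast
  obtain g where g: "inj_on g (verts H)" "g ` verts H \<subseteq> verts G"
    "\<forall>u\<in>verts H. \<forall>v\<in>verts H. adjacent H u v \<longleftrightarrow> adjacent G (g u) (g v)"
    using assms(2) unfolding embeds_def by blast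
  have "inj_on (g \<circ> f) (verts F)"
    using f(1) inj_on_subset[OF g(1) f(2)] by (rule comp_inj_on)
  moreover have "(g \<circ> f) ` verts F \<subseteq> verts G" using f(2) g(2) by auto
  moreover have "\<forall>u\<in>verts F. \<forall>v\<in>verts F. adjacent F u v \<longleftrightarrow> adjacent G ((g \<circ> f) u) ((g \<circ> f) v)"
    using f(2,3) g(3) by (simp add: image_subset_iff)
  ultimately show ?thesis unfolding embeds_def by blast
qed

lemma induced_isomorphic_iff_embeds:
  "(\<exists>W\<subseteq>verts G. induced G W \<simeq> H) \<longleftrightarrow> embeds H G"
proof
  assume "\<exists>W\<subseteq>verts G. induced G W \<simeq> H"
  then obtain W f where W: "W \<subseteq> verts G" and f: "bij_betw f (verts (induced G W)) (verts H)"
    and adj: "\<forall>u\<in>verts (induced G W). \<forall>v\<in>verts (induced G W).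
      adjacent (induced G W) u v \<longleftrightarrow> adjacent H (f u) (f v)"
    unfolding isomorphic_def by blast
  have V: "verts (induced G W) = W" using W by (auto simp: induced_def)
  define g where "g = inv_into W f"
  have g: "bij_betw g (verts H) W"
    unfolding g_def using f V by (simp add: bij_betw_inv_into)
  have gW: "g u \<in> W" "f (g u) = u" if "u \<in> verts H" for u
    using f V that g bij_betw_inv_into_right[of f W "verts H" u]
    by (auto simp: g_def bij_betw_def)
  have "adjacent H u v \<longleftrightarrow> adjacent G (g u) (g v)" if "u \<in> verts H" "v \<in> verts H" for u v
  proof -
    have "adjacent H u v \<longleftrightarrow> adjacent (induced G W) (g u) (g v)"
      using adj gW that V by simp
    also have "\<dots> \<longleftrightarrow> adjacent G (g u) (g v)"
      using gW that by (simp add: adjacent_def induced_def)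
    finally show ?thesis .
  qed
  then show "embeds H G"
    unfolding embeds_def using g W by (intro exI[of _ g]) (auto simp: bij_betw_def)
next
  assume "embeds H G"
  then obtain f where f: "inj_on f (verts H)" "f ` verts H \<subseteq> verts G"
    and adj: "\<forall>u\<in>verts H. \<forall>v\<in>verts H. adjacent H u v \<longleftrightarrow> adjacent G (f u) (f v)"
    unfolding embeds_def by blast
  define W where "W = f ` verts H"
  define g where "g = inv_into (verts H) f"
  have V: "verts (induced G W) = W" using f(2) by (auto simp: induced_def W_def)
  have "bij_betw g W (verts H)"
    unfolding g_def W_def using f(1) by (simp add: bij_betw_inv_into bij_betw_imageI)
  moreover have gH: "g x \<in> verts H" "f (g x) = x" if "x \<in> W" for x
    using that unfolding g_def W_def by (auto simp: inv_into_into f_inv_into_f)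
  moreover have "adjacent (induced G W) x y \<longleftrightarrow> adjacent H (g x) (g y)" if "x \<in> W" "y \<in> W" for x y
    using that gH adj by (simp add: adjacent_def induced_def)
  ultimately have "induced G W \<simeq> H" unfolding isomorphic_def V by blast
  then show "\<exists>W\<subseteq>verts G. induced G W \<simeq> H" using f(2) unfolding W_def by blast
qed

lemma free_graphs_iff:
  "G \<in> free_graphs \<F> \<longleftrightarrow> simple_graph G \<and> (\<forall>H\<in>\<F>. \<not> embeds H G)"
  unfolding free_graphs_def induced_isomorphic_iff_embeds[symmetric] by blast

lemma not_family_leE:
  assumes "\<not> \<F>' \<unlhd> \<F>"
  obtains H where "H \<in> \<F>" "\<And>K. K \<in> \<F>' \<Longrightarrow> \<not> embeds K H"
  using assms embeds_trans unfolding family_le_def subset_iff free_graphs_iff by blast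

lemma embeds_same_card_isomorphic:
  assumes "embeds H G" "simple_graph G" "card (verts G) = card (verts H)"
  shows "H \<simeq> G"
proof -
  obtain f where f: "inj_on f (verts H)" "f ` verts H \<subseteq> verts G"
    "\<forall>u\<in>verts H. \<forall>v\<in>verts H. adjacent H u v \<longleftrightarrow> adjacent G (f u) (f v)"
    using assms(1) unfolding embeds_def by blast
  have "f ` verts H = verts G"
    using f(1,2) assms(2,3) by (simp add: simple_graph_def card_subset_eq card_image)
  then show ?thesis using f unfolding isomorphic_def bij_betw_def by blast
qed

text \<open>
  For simple graphs the adjacencies need to be compared only in increasing order of positions.
\<close>

lemma embeds_listI:
  assumes simple: "simple_graph H" "simple_graph G"
    and xs: "verts H = set xs" "distinct xs"
    and ys: "set ys \<subseteq> verts G" "distinct ys" "length ys = length xs"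
    and adj: "\<And>i j. i < j \<Longrightarrow> j < length xs \<Longrightarrow>
      adjacent H (xs ! i) (xs ! j) \<longleftrightarrow> adjacent G (ys ! i) (ys ! j)"
  shows "embeds H G"
proof -
  define f where "f = the \<circ> map_of (zip xs ys)"
  have f: "f (xs ! i) = ys ! i" if "i < length xs" for i
    using that xs ys by (simp add: f_def map_of_zip_nth)
  have index: "\<exists>i<length xs. u = xs ! i" if "u \<in> set xs" for u
    using that by (auto simp: in_set_conv_nth)
  have "inj_on f (set xs)"
  proof (rule inj_onI)
    fix u v assume uv: "u \<in> set xs" "v \<in> set xs" "f u = f v"
    obtain i j where "i < length xs" "u = xs ! i" "j < length xs" "v = xs ! j"
      using index uv by metis
    then show "u = v" using uv(3) f ys by (simp add: nth_eq_iff_index_eq)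
  qed
  moreover have "f u \<in> verts G" if u: "u \<in> set xs" for u
  proof -
    obtain i where "i < length xs" "u = xs ! i" using index u by metis
    then show ?thesis using f ys nth_mem[of i ys] by auto
  qed
  moreover have "adjacent H u v \<longleftrightarrow> adjacent G (f u) (f v)" if uv: "u \<in> set xs" "v \<in> set xs" for u v
  proof -
    obtain i j where ij: "i < length xs" "u = xs ! i" "j < length xs" "v = xs ! j"
      using index uv by metis
    consider "i < j" | "i = j" | "j < i" by linarith
    then show ?thesis
    proof cases
      case 3
      then show ?thesis
        using adj[of j i] ij f adjacent_commute[of H u v] adjacent_commute[of G "f u" "f v"] by simp
    qed (use ij f adj simple_irrefl[OF simple(1)] simple_irrefl[OF simple(2)] in simp_all)
  qed
  ultimately show ?thesis
    unfolding embeds_def xs(1) by (intro exI[of _ f]) (simp add: image_subset_iff)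
qed

lemma less_numeral_cases:
  fixes i j :: nat
  shows "i < j \<Longrightarrow> j < 3 \<Longrightarrow> (i, j) \<in> {(0, 1), (0, 2), (1, 2)}"
    and "i < j \<Longrightarrow> j < 4 \<Longrightarrow> (i, j) \<in> {(0, 1), (0, 2), (1, 2), (0, 3), (1, 3), (2, 3)}"
  by auto

lemma contains_embeds:
  assumes "contains H w" "embeds H G"
  shows "contains G w"
proof -
  obtain a b c d where abcd: "{a, b, c, d} \<subseteq> verts H" "distinct [a, b, c, d]" "pattern H a b c d = w"
    using assms(1) unfolding contains_def by blast
  obtain f where f: "inj_on f (verts H)" "f ` verts H \<subseteq> verts G"
    "\<forall>u\<in>verts H. \<forall>v\<in>verts H. adjacent H u v \<longleftrightarrow> adjacent G (f u) (f v)"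
    using assms(2) unfolding embeds_def by blast
  show ?thesis
  proof (rule containsI)
    show "{f a, f b, f c, f d} \<subseteq> verts G" using abcd(1) f(2) by auto
    show "distinct [f a, f b, f c, f d]"
      using abcd(1,2) f(1) by (auto simp: inj_on_eq_iff)
    show "pattern G (f a) (f b) (f c) (f d) = w"
      using abcd(1,3) f(3) by (simp add: pattern_def)
  qed
qed

lemma embeds_if_contains:
  assumes H: "simple_graph H" "card (verts H) = 4" and G: "simple_graph G"
    and w: "contains H w" "contains G w"
  shows "embeds H G"
proof -
  obtain a b c d where abcd: "{a, b, c, d} \<subseteq> verts H" "distinct [a, b, c, d]" "pattern H a b c d = w"
    using w(1) unfolding contains_def by blast
  obtain a' b' c' d' where abcd': "{a', b', c', d'} \<subseteq> verts G" "distinct [a', b', c', d']"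
    "pattern G a' b' c' d' = w"
    using w(2) unfolding contains_def by blast
  have "card {a, b, c, d} = 4" using abcd(2) by simp
  then have VH: "verts H = {a, b, c, d}"
    using abcd(1) H card_subset_eq[of "verts H" "{a, b, c, d}"] by (simp add: simple_graph_def)
  have eq: "adjacent H a b = adjacent G a' b'" "adjacent H a c = adjacent G a' c'"
    "adjacent H a d = adjacent G a' d'" "adjacent H b c = adjacent G b' c'"
    "adjacent H b d = adjacent G b' d'" "adjacent H c d = adjacent G c' d'"
    using trans[OF abcd(3) abcd'(3)[symmetric]] by (simp_all add: pattern_def)
  show ?thesis
  proof (intro embeds_listI[where xs = "[a, b, c, d]" and ys = "[a', b', c', d']", OF H(1) G])
    fix i j :: nat assume "i < j" "j < length [a, b, c, d]"
    then have "(i, j) \<in> {(0, 1), (0, 2), (1, 2), (0, 3), (1, 3), (2, 3)}"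
      by (intro less_numeral_cases) auto
    then show "adjacent H ([a, b, c, d] ! i) ([a, b, c, d] ! j) \<longleftrightarrow>
        adjacent G ([a', b', c', d'] ! i) ([a', b', c', d'] ! j)"
      using eq by (elim insertE emptyE) simp_all
  qed (use VH abcd(2) abcd'(1,2) in auto)
qed

lemma card_four_pattern:
  assumes "simple_graph H" "card (verts H) = 4"
  shows "\<exists>w\<in>{P4_pat, two_K2_pat, co_diamond_pat, P3_K1_pat, four_K1_pat, claw_pat, K3_K1_pat,
    paw_pat, K4_pat, C4_pat, diamond_pat}. contains H w"
proof -
  obtain a b c d where abcd: "{a, b, c, d} \<subseteq> verts H" "distinct [a, b, c, d]"
    using four_distinct[of "verts H"] assms(2) by (metis order_refl)
  have perm: "contains H (pattern H x y z w)"
    if "{x, y, z, w} \<subseteq> {a, b, c, d}" "distinct [x, y, z, w]" for x y z w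
    using abcd(1) that by (intro containsI[OF _ that(2) refl]) blast
  \<comment> \<open>All labellings, so that each of the 64 possible adjacency patterns meets a listed one.\<close>
  have perms: "contains H w" if "w \<in> {
        pattern H a b c d, pattern H a b d c, pattern H a c b d, pattern H a c d b,
        pattern H a d b c, pattern H a d c b, pattern H b a c d, pattern H b a d c,
        pattern H b c a d, pattern H b c d a, pattern H b d a c, pattern H b d c a,
        pattern H c a b d, pattern H c a d b, pattern H c b a d, pattern H c b d a,
        pattern H c d a b, pattern H c d b a, pattern H d a b c, pattern H d a c b,
        pattern H d b a c, pattern H d b c a, pattern H d c a b, pattern H d c b a}" for w
    using that abcd(2) by (auto intro: perm)
  show ?thesis
    using perms unfolding pattern_def P4_pat_def two_K2_pat_def co_diamond_pat_def P3_K1_pat_def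
      four_K1_pat_def claw_pat_def K3_K1_pat_def paw_pat_def K4_pat_def C4_pat_def diamond_pat_def
      adjacent_commute[of H b a] adjacent_commute[of H c a] adjacent_commute[of H d a]
      adjacent_commute[of H c b] adjacent_commute[of H d b] adjacent_commute[of H d c]
    by (cases "adjacent H a b"; cases "adjacent H a c"; cases "adjacent H a d";
        cases "adjacent H b c"; cases "adjacent H b d"; cases "adjacent H c d") simp_all
qed

definition below :: "nat graph \<Rightarrow> bool list \<Rightarrow> bool" where
  "below H w \<longleftrightarrow> (\<forall>G :: nat graph. simple_graph G \<longrightarrow> contains G w \<longrightarrow> embeds H G)"

lemma embeds_K3I:
  assumes "simple_graph H" "adjacent H a b" "adjacent H b c" "adjacent H a c"
  shows "embeds (complete_graph 3) H"
proof -
  have K: "adjacent (complete_graph 3) i j" if "i < j" "j < 3" for i j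
    using that unfolding adjacent_def complete_graph_def
    by (simp, intro exI[of _ i] exI[of _ j], simp)
  show ?thesis
  proof (intro embeds_listI[where xs = "[0, 1, 2]" and ys = "[a, b, c]"])
    fix i j :: nat assume ij: "i < j" "j < length [0 :: nat, 1, 2]"
    then have "(i, j) \<in> {(0, 1), (0, 2), (1, 2)}" by (intro less_numeral_cases) auto
    then show "adjacent (complete_graph 3) ([0, 1, 2] ! i) ([0, 1, 2] ! j) \<longleftrightarrow>
        adjacent H ([a, b, c] ! i) ([a, b, c] ! j)"
      using assms K by auto
  qed (use assms adjacentD[OF assms(1)] simple_graph_complete_graph in
      \<open>auto simp: complete_graph_def\<close>)
qed

lemma not_adjacent_copies_P1: "\<not> adjacent (copies k (path_graph 1)) x y"
  by (auto simp: adjacent_def copies_def path_graph_def)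

lemma verts_copies_P1: "verts (copies k (path_graph 1)) = (\<lambda>i. prod_encode (i, 0)) ` {..<k}"
  by (auto simp: copies_def path_graph_def)

lemma embeds_3P1I:
  assumes "simple_graph H" "{a, b, c} \<subseteq> verts H" "distinct [a, b, c]"
    "\<not> adjacent H a b" "\<not> adjacent H b c" "\<not> adjacent H a c"
  shows "embeds (copies 3 (path_graph 1)) H"
proof -
  let ?xs = "map (\<lambda>i. prod_encode (i, 0)) [0, 1, 2]"
  show ?thesis
  proof (intro embeds_listI[where xs = ?xs and ys = "[a, b, c]"])
    show "simple_graph (copies 3 (path_graph 1))"
      by (intro simple_graph_copies simple_graph_path_graph) auto
    show "verts (copies 3 (path_graph 1)) = set ?xs"
      unfolding verts_copies_P1 by (auto simp: numeral_eq_Suc lessThan_Suc)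
    fix i j :: nat assume ij: "i < j" "j < length ?xs"
    then have "(i, j) \<in> {(0, 1), (0, 2), (1, 2)}" by (intro less_numeral_cases) auto
    then show "adjacent (copies 3 (path_graph 1)) (?xs ! i) (?xs ! j) \<longleftrightarrow>
        adjacent H ([a, b, c] ! i) ([a, b, c] ! j)"
      using assms not_adjacent_copies_P1 by auto
  qed (use assms in auto)
qed

section \<open>The graphs with at most four vertices\<close>

lemma verts_complete_graph: "verts (complete_graph n) = {..<n}"
  by (simp add: complete_graph_def)

lemma adjacent_complete_graph: "adjacent (complete_graph n) i j \<longleftrightarrow> i < n \<and> j < n \<and> i \<noteq> j"
  unfolding adjacent_def complete_graph_def graph.sel mem_Collect_eq doubleton_eq_iff by blast

lemma verts_diamond: "verts diamond = {..<4}"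
  by (simp add: diamond_def verts_complete_graph)

lemma adjacent_diamond: "adjacent diamond i j \<longleftrightarrow> i < 4 \<and> j < 4 \<and> i \<noteq> j \<and>
    \<not> (i = 0 \<and> j = 1) \<and> \<not> (i = 1 \<and> j = 0)"
  using adjacent_complete_graph[of 4 i j]
  unfolding diamond_def adjacent_def graph.sel Diff_iff singleton_iff doubleton_eq_iff by blast

lemma contains_named:
  "contains claw claw_pat" "contains diamond diamond_pat" "contains (complete_graph 4) K4_pat"
  "contains (cycle_graph 4) C4_pat" "contains (copies 4 (path_graph 1)) four_K1_pat"
proof -
  show "contains claw claw_pat"
    by (rule containsI[of 0 1 2 3])
      (simp_all add: pattern_def claw_pat_def claw_def complete_bipartite_def adjacent_def doubleton_eq_iff)
  show "contains diamond diamond_pat"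
    by (rule containsI[of 0 1 2 3])
      (simp_all add: pattern_def diamond_pat_def adjacent_diamond verts_diamond)
  show "contains (complete_graph 4) K4_pat"
    by (rule containsI[of 0 1 2 3])
      (simp_all add: pattern_def K4_pat_def adjacent_complete_graph verts_complete_graph)
  show "contains (cycle_graph 4) C4_pat"
  proof (rule containsI[of 0 1 2 3])
    have "edges (cycle_graph 4) = (\<lambda>i. {i, (i + 1) mod 4}) ` {..<4}"
      by (auto simp: cycle_graph_def)
    moreover have "{..<4 :: nat} = {0, 1, 2, 3}" by auto
    moreover have "(0 + 1) mod 4 = (1 :: nat)" "(1 + 1) mod 4 = (2 :: nat)"
      "(2 + 1) mod 4 = (3 :: nat)" "(3 + 1) mod 4 = (0 :: nat)" by simp_all
    ultimately have E: "edges (cycle_graph 4) = {{0, 1}, {1, 2}, {2, 3}, {3, 0}}"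
      by (simp only: image_insert image_empty)
    show "pattern (cycle_graph 4) 0 1 2 3 = C4_pat"
      by (simp add: pattern_def C4_pat_def adjacent_def E doubleton_eq_iff)
  qed (simp_all add: cycle_graph_def)
  show "contains (copies 4 (path_graph 1)) four_K1_pat"
    by (rule containsI[of "prod_encode (0, 0)" "prod_encode (1, 0)" "prod_encode (2, 0)" "prod_encode (3, 0)"])
      (simp_all add: pattern_def four_K1_pat_def verts_copies_P1 not_adjacent_copies_P1 del: One_nat_def)
qed

lemma card_named:
  "card (verts claw) = 4" "card (verts diamond) = 4" "card (verts (complete_graph 4)) = 4"
  "card (verts (cycle_graph 4)) = 4" "card (verts (copies 4 (path_graph 1))) = 4"
proof -
  have "inj_on (\<lambda>i. prod_encode (i, 0)) {..<4}" by (simp add: inj_on_def)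
  then show "card (verts (copies 4 (path_graph 1))) = 4"
    unfolding verts_copies_P1 by (simp add: card_image)
qed (simp_all add: claw_def complete_bipartite_def verts_diamond verts_complete_graph cycle_graph_def)

lemma simple_named:
  "simple_graph claw" "simple_graph diamond" "simple_graph (complete_graph 4)"
  "simple_graph (cycle_graph 4)" "simple_graph (copies 4 (path_graph 1))"
proof -
  show "simple_graph (complete_graph 4)" by (rule simple_graph_complete_graph) simp
  show "simple_graph (cycle_graph 4)" by (rule simple_graph_cycle_graph) simp
  show "simple_graph (copies 4 (path_graph 1))"
    by (intro simple_graph_copies simple_graph_path_graph) simp_all
qed (rule simple_graph_claw simple_graph_diamond)+

text \<open>
  A graph on at most three vertices is an induced subgraph of \<open>P\<^sub>4\<close>, except for \<open>3P\<^sub>1\<close> and \<open>K\<^sub>3\<close>. For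
  \<open>3P\<^sub>1\<close> the co-diamond is chosen and not \<open>4P\<^sub>1\<close>, because \<open>4P\<^sub>1\<close> belongs to the exceptional families.
\<close>

lemma card_less_four_below:
  fixes H :: "nat graph"
  assumes H: "simple_graph H" "card (verts H) < 4"
  shows "below H P4_pat \<or> below H co_diamond_pat \<and> embeds (copies 3 (path_graph 1)) H \<or>
    below H paw_pat \<and> embeds (complete_graph 3) H"
proof -
  note sH = simple_irrefl[OF H(1)]
  have fin: "finite (verts H)" "verts H \<noteq> {}" using H(1) by (auto simp: simple_graph_def)
  then have "card (verts H) \<noteq> 0" by simp
  then consider "card (verts H) = 1" | "card (verts H) = 2" | "card (verts H) = 3"
    using H(2) by linarith
  then show ?thesis
  proof cases
    case 1
    then obtain a where a: "verts H = {a}" by (auto simp: card_1_singleton_iff)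
    have "below H P4_pat"
      unfolding below_def
    proof (intro allI impI)
      fix G :: "nat graph" assume G: "simple_graph G" "contains G P4_pat"
      then obtain x where "x \<in> verts G" unfolding contains_def by blast
      then show "embeds H G"
        using G(1) H(1) a by (intro embeds_listI[where xs = "[a]" and ys = "[x]"]) auto
    qed
    then show ?thesis by blast
  next
    case 2
    then obtain a b where ab: "verts H = {a, b}" "a \<noteq> b" by (auto simp: card_2_iff)
    have "below H P4_pat"
      unfolding below_def
    proof (intro allI impI)
      fix G :: "nat graph" assume G: "simple_graph G" "contains G P4_pat"
      then obtain x y z w where xyzw: "{x, y, z, w} \<subseteq> verts G" "distinct [x, y, z, w]"
        "pattern G x y z w = P4_pat"
        unfolding contains_def by blast
      then have P: "adjacent G x y" "\<not> adjacent G x z" by (auto simp: pattern_def P4_pat_def)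
      show "embeds H G"
        using G(1) H(1) ab xyzw(1,2) P
        by (intro embeds_listI[where xs = "[a, b]" and ys = "[x, if adjacent H a b then y else z]"])
          (auto simp: less_Suc_eq)
    qed
    then show ?thesis by blast
  next
    case 3
    then obtain a b c where abc: "verts H = {a, b, c}" "distinct [a, b, c]"
      by (auto simp: card_3_iff)
    have emb: "embeds H G"
      if "simple_graph G" "{x, y, z} \<subseteq> verts G" "distinct [x, y, z]"
        "adjacent H a b = adjacent G x y" "adjacent H a c = adjacent G x z"
        "adjacent H b c = adjacent G y z" for G :: "nat graph" and x y z
    proof (intro embeds_listI[where xs = "[a, b, c]" and ys = "[x, y, z]"])
      fix i j :: nat assume "i < j" "j < length [a, b, c]"
      then have "(i, j) \<in> {(0, 1), (0, 2), (1, 2)}" by (intro less_numeral_cases) auto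
      then show "adjacent H ([a, b, c] ! i) ([a, b, c] ! j) \<longleftrightarrow>
          adjacent G ([x, y, z] ! i) ([x, y, z] ! j)"
        using that(4-6) by (elim insertE emptyE) simp_all
    qed (use that abc H in auto)
    consider "adjacent H a b" "adjacent H a c" "adjacent H b c"
      | "\<not> adjacent H a b" "\<not> adjacent H a c" "\<not> adjacent H b c"
      | "\<not> (adjacent H a b \<and> adjacent H a c \<and> adjacent H b c)"
        "adjacent H a b \<or> adjacent H a c \<or> adjacent H b c" by blast
    then show ?thesis
    proof cases
      case 1
      have "embeds H G" if G: "simple_graph G" "contains G paw_pat" for G :: "nat graph"
      proof -
        obtain x y z w where xyzw: "{x, y, z, w} \<subseteq> verts G" "distinct [x, y, z, w]"
          "pattern G x y z w = paw_pat"
          using G(2) unfolding contains_def by blast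
        then show ?thesis
          using 1 G(1) by (intro emb[of G x y z]) (auto simp: pattern_def paw_pat_def)
      qed
      moreover have "embeds (complete_graph 3) H" using embeds_K3I[OF H(1)] 1 by blast
      ultimately show ?thesis unfolding below_def by blast
    next
      case 2
      have "embeds H G" if G: "simple_graph G" "contains G co_diamond_pat" for G :: "nat graph"
      proof -
        obtain x y z w where xyzw: "{x, y, z, w} \<subseteq> verts G" "distinct [x, y, z, w]"
          "pattern G x y z w = co_diamond_pat"
          using G(2) unfolding contains_def by blast
        then show ?thesis
          using 2 G(1) by (intro emb[of G x z w]) (auto simp: pattern_def co_diamond_pat_def)
      qed
      moreover have "embeds (copies 3 (path_graph 1)) H"
        using embeds_3P1I[OF H(1), of a b c] 2 abc by simp
      ultimately show ?thesis unfolding below_def by blast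
    next
      case 3
      have "embeds H G" if G: "simple_graph G" "contains G P4_pat" for G :: "nat graph"
      proof -
        obtain x y z w where xyzw: "{x, y, z, w} \<subseteq> verts G" "distinct [x, y, z, w]"
          "pattern G x y z w = P4_pat"
          using G(2) unfolding contains_def by blast
        have adj: "adjacent G x y" "adjacent G y x" "adjacent G y z" "adjacent G z y"
          "\<not> adjacent G x z" "\<not> adjacent G z x" "\<not> adjacent G x w" "\<not> adjacent G w x"
          "\<not> adjacent G y w" "\<not> adjacent G w y"
          using xyzw(3) adjacent_commute[of G] by (auto simp: pattern_def P4_pat_def)
        have dist: "distinct [x, y, w]" "distinct [x, w, y]" "distinct [w, x, y]"
          "distinct [y, x, z]" "distinct [x, y, z]" "distinct [x, z, y]"
          using xyzw(2) by auto
        have sub: "{x, y, w} \<subseteq> verts G" "{x, w, y} \<subseteq> verts G" "{w, x, y} \<subseteq> verts G"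
          "{y, x, z} \<subseteq> verts G" "{x, y, z} \<subseteq> verts G" "{x, z, y} \<subseteq> verts G"
          using xyzw(1) by auto
        show ?thesis
          using emb[OF G(1) sub(1) dist(1)] emb[OF G(1) sub(2) dist(2)]
            emb[OF G(1) sub(3) dist(3)] emb[OF G(1) sub(4) dist(4)]
            emb[OF G(1) sub(5) dist(5)] emb[OF G(1) sub(6) dist(6)] adj 3
          by argo
      qed
      then show ?thesis unfolding below_def by blast
    qed
  qed
qed

text \<open>
  The induced subgraphs \<open>3P\<^sub>1\<close>, \<open>K\<^sub>3\<close> and the named graphs are recorded in each case because they decide
  which cases remain for a member of \<open>\<F>\<close> that is free of one of the three families.
\<close>

lemma small_graph_cases:
  fixes H :: "nat graph"
  assumes H: "simple_graph H" "card (verts H) \<le> 4"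
  shows "below H P4_pat \<or> below H two_K2_pat \<or>
    (below H co_diamond_pat \<or> below H P3_K1_pat) \<and> embeds (copies 3 (path_graph 1)) H \<or>
    below H four_K1_pat \<and> H \<simeq> copies 4 (path_graph 1) \<and> embeds (copies 3 (path_graph 1)) H \<or>
    below H claw_pat \<and> H \<simeq> claw \<and> embeds claw H \<and> embeds (copies 3 (path_graph 1)) H \<or>
    (below H K3_K1_pat \<or> below H paw_pat) \<and> embeds (complete_graph 3) H \<or>
    below H K4_pat \<and> embeds (complete_graph 4) H \<and> embeds (complete_graph 3) H \<or>
    below H C4_pat \<and> H \<simeq> cycle_graph 4 \<and> embeds (cycle_graph 4) H \<or>
    below H diamond_pat \<and> embeds diamond H \<and> embeds (complete_graph 3) H"
proof (cases "card (verts H) = 4")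
  case False
  then show ?thesis using card_less_four_below[OF H(1)] H(2) by force
next
  case True
  obtain w where w: "w \<in> {P4_pat, two_K2_pat, co_diamond_pat, P3_K1_pat, four_K1_pat, claw_pat,
      K3_K1_pat, paw_pat, K4_pat, C4_pat, diamond_pat}" "contains H w"
    using card_four_pattern[OF H(1) True] by blast
  have below: "below H w"
    unfolding below_def using embeds_if_contains[OF H(1) True _ w(2)] by blast
  have named: "H \<simeq> K \<and> embeds K H"
    if "simple_graph K" "card (verts K) = 4" "contains K w" for K :: "nat graph"
    using embeds_same_card_isomorphic[of H K] embeds_if_contains[OF H(1) True that(1) w(2) that(3)]
      embeds_if_contains[OF that(1,2) H(1) that(3) w(2)] that True by simp
  obtain a b c d where abcd: "{a, b, c, d} \<subseteq> verts H" "distinct [a, b, c, d]" "pattern H a b c d = w"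
    using w(2) unfolding contains_def by blast
  have K3: "embeds (complete_graph 3) H"
    if "w \<in> {K3_K1_pat, paw_pat, K4_pat}"
    using that abcd(3) by (intro embeds_K3I[OF H(1), of a b c])
      (auto simp: pattern_def K3_K1_pat_def paw_pat_def K4_pat_def)
  have K3': "embeds (complete_graph 3) H" if "w = diamond_pat"
    using that abcd(3) by (intro embeds_K3I[OF H(1), of b c d])
      (auto simp: pattern_def diamond_pat_def)
  have P1: "embeds (copies 3 (path_graph 1)) H" if "w \<in> {co_diamond_pat, four_K1_pat}"
    using that abcd by (intro embeds_3P1I[OF H(1), of b c d])
      (auto simp: pattern_def co_diamond_pat_def four_K1_pat_def)
  have P1': "embeds (copies 3 (path_graph 1)) H" if "w = claw_pat"
    using that abcd by (intro embeds_3P1I[OF H(1), of b c d])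
      (auto simp: pattern_def claw_pat_def)
  have P1'': "embeds (copies 3 (path_graph 1)) H" if "w = P3_K1_pat"
    using that abcd by (intro embeds_3P1I[OF H(1), of a c d])
      (auto simp: pattern_def P3_K1_pat_def)
  show ?thesis
    using w(1) below K3 K3' P1 P1' P1'' named[OF simple_named(1) card_named(1)]
      named[OF simple_named(2) card_named(2)] named[OF simple_named(3) card_named(3)]
      named[OF simple_named(4) card_named(4)] named[OF simple_named(5) card_named(5)] contains_named
    by (elim insertE emptyE) simp_all
qed

section \<open>Families outside the three obstructions are tame\<close>

lemma tame_if_components_describable:
  assumes "6 \<le> k" "\<And>G. G \<in> \<G> \<Longrightarrow> simple_graph G"
    and "\<And>G S A B. G \<in> \<G> \<Longrightarrow> full_components G S A B \<Longrightarrow> S \<in> describable k G"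
  shows "tame \<G>"
  using assms(1,2)
proof (rule tame_if_describable)
  fix G assume G: "G \<in> \<G>"
  show "minimal_separators G \<subseteq> describable k G"
  proof
    fix S assume "S \<in> minimal_separators G"
    then obtain A B where "full_components G S A B"
      using minimal_separator_full_components assms(2)[OF G] by blast
    then show "S \<in> describable k G" by (rule assms(3)[OF G])
  qed
qed

text \<open>
  The size bound \<open>r + 6\<close> covers the sets that Ramsey's theorem bounds by \<open>r\<close>, and it leaves room for the
  six vertices of the last describable shape.
\<close>

lemma tame_if_avoids_patterns:
  fixes \<G> :: "nat graph set"
  assumes simple: "\<And>G. G \<in> \<G> \<Longrightarrow> simple_graph G"
    and avoids: "\<And>w G. avoided w \<Longrightarrow> G \<in> \<G> \<Longrightarrow> \<not> contains G w"
    and cases: "avoided P4_pat \<or> avoided two_K2_pat \<or>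
      (avoided co_diamond_pat \<or> avoided P3_K1_pat) \<and>
        (avoided K3_K1_pat \<or> avoided paw_pat \<or> avoided K4_pat \<or> avoided C4_pat) \<or>
      avoided four_K1_pat \<and> (avoided K3_K1_pat \<or> avoided paw_pat \<or> avoided K4_pat \<or>
        avoided C4_pat \<and> avoided diamond_pat) \<or>
      avoided claw_pat \<and> (avoided K3_K1_pat \<or> avoided paw_pat)"
  shows "tame \<G>"
proof -
  obtain r where r: "ramsey_4_4 TYPE(nat) r" using ex_ramsey_4_4 by blast
  show ?thesis
  proof (rule tame_if_components_describable[of "r + 6"])
    fix G S A B assume G: "G \<in> \<G>" and "full_components G S A B"
    then interpret full_components G S A B by simp
    note a = avoids[OF _ G]
    from cases show "S \<in> describable (r + 6) G"
    proof (elim disjE conjE)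
      assume "avoided P4_pat"
      then show ?thesis using P4_free_describable a by blast
    next
      assume "avoided two_K2_pat"
      then show ?thesis using two_K2_free_describable a by simp
    qed (rule sparse_describable four_K1_free_describable[OF r] claw_free_describable;
        use a in simp)+
  qed (use simple in auto)
qed

text \<open>
  Each of the three families contributes a member of \<open>\<F>\<close> without an induced subgraph from it. Going
  through the cases for these three graphs, the forbidden patterns always include a combination treated
  above, except when the only information is that \<open>\<F>\<close> contains \<open>4P\<^sub>1\<close> and \<open>C\<^sub>4\<close>. In that case \<open>\<F>\<close> has
  another member that is not the claw either, and it supplies a third pattern.
\<close>

lemma tame_if_no_obstruction:
  fixes \<F> :: "nat graph set"
  assumes small: "\<And>H. H \<in> \<F> \<Longrightarrow> simple_graph H \<and> card (verts H) \<le> 4"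
    and exception: "\<not> \<F> \<doteq> {copies 4 (path_graph 1), cycle_graph 4}"
      "\<not> \<F> \<doteq> {copies 4 (path_graph 1), cycle_graph 4, claw}"
    and i: "\<not> {copies 3 (path_graph 1), diamond} \<unlhd> \<F>"
    and ii: "\<not> {claw, complete_graph 4, cycle_graph 4, diamond} \<unlhd> \<F>"
    and iii: "\<not> {complete_graph 3, cycle_graph 4} \<unlhd> \<F>"
  shows "tame (free_graphs \<F>)"
proof (rule tame_if_avoids_patterns)
  define avoided where "avoided w \<longleftrightarrow> (\<exists>H\<in>\<F>. below H w)" for w
  show "\<not> contains G w" if "avoided w" "G \<in> free_graphs \<F>" for w G
    using that unfolding avoided_def below_def free_graphs_iff by blast
  note classify = small_graph_cases[OF conjunct1[OF small] conjunct2[OF small]]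
  have 1: "avoided P4_pat \<or> avoided two_K2_pat \<or> avoided K3_K1_pat \<or> avoided paw_pat \<or>
      avoided K4_pat \<or> avoided C4_pat \<and> (\<exists>H\<in>\<F>. H \<simeq> cycle_graph 4)"
  proof -
    obtain H where H: "H \<in> \<F>" "\<not> embeds (copies 3 (path_graph 1)) H" "\<not> embeds diamond H"
      using not_family_leE[OF i] by (metis insertCI)
    show ?thesis using classify[OF H(1) H(1)] H unfolding avoided_def by blast
  qed
  have 2: "avoided P4_pat \<or> avoided two_K2_pat \<or> avoided co_diamond_pat \<or> avoided P3_K1_pat \<or>
      avoided four_K1_pat \<and> (\<exists>H\<in>\<F>. H \<simeq> copies 4 (path_graph 1)) \<or>
      avoided K3_K1_pat \<or> avoided paw_pat"
  proof -
    obtain H where H: "H \<in> \<F>" "\<not> embeds claw H" "\<not> embeds (complete_graph 4) H"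
        "\<not> embeds (cycle_graph 4) H" "\<not> embeds diamond H"
      using not_family_leE[OF ii] by (metis insertCI)
    show ?thesis using classify[OF H(1) H(1)] H unfolding avoided_def by blast
  qed
  have 3: "avoided P4_pat \<or> avoided two_K2_pat \<or> avoided co_diamond_pat \<or> avoided P3_K1_pat \<or>
      avoided four_K1_pat \<and> (\<exists>H\<in>\<F>. H \<simeq> copies 4 (path_graph 1)) \<or> avoided claw_pat"
  proof -
    obtain H where H: "H \<in> \<F>" "\<not> embeds (complete_graph 3) H" "\<not> embeds (cycle_graph 4) H"
      using not_family_leE[OF iii] by (metis insertCI)
    show ?thesis using classify[OF H(1) H(1)] H unfolding avoided_def by blast
  qed
  have 4: "avoided P4_pat \<or> avoided two_K2_pat \<or> avoided co_diamond_pat \<or> avoided P3_K1_pat \<or>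
      avoided K3_K1_pat \<or> avoided paw_pat \<or> avoided K4_pat \<or> avoided diamond_pat"
    if "\<exists>H\<in>\<F>. H \<simeq> cycle_graph 4" "\<exists>H\<in>\<F>. H \<simeq> copies 4 (path_graph 1)"
  proof -
    have "\<exists>H\<in>\<F>. \<not> H \<simeq> copies 4 (path_graph 1) \<and> \<not> H \<simeq> cycle_graph 4 \<and> \<not> H \<simeq> claw"
    proof (rule ccontr)
      assume no: "\<not> ?thesis"
      show False
      proof (cases "\<exists>H\<in>\<F>. H \<simeq> claw")
        case True
        then show False using exception(2) no that unfolding family_eq_def by blast
      next
        case False
        then show False using exception(1) no that unfolding family_eq_def by blast
      qed
    qed
    then obtain H where H: "H \<in> \<F>" "\<not> H \<simeq> copies 4 (path_graph 1)" "\<not> H \<simeq> cycle_graph 4"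
      "\<not> H \<simeq> claw" by blast
    show ?thesis using classify[OF H(1) H(1)] H unfolding avoided_def by blast
  qed
  show "avoided P4_pat \<or> avoided two_K2_pat \<or>
      (avoided co_diamond_pat \<or> avoided P3_K1_pat) \<and>
        (avoided K3_K1_pat \<or> avoided paw_pat \<or> avoided K4_pat \<or> avoided C4_pat) \<or>
      avoided four_K1_pat \<and> (avoided K3_K1_pat \<or> avoided paw_pat \<or> avoided K4_pat \<or>
        avoided C4_pat \<and> avoided diamond_pat) \<or>
      avoided claw_pat \<and> (avoided K3_K1_pat \<or> avoided paw_pat)"
    using 1 2 3 4 by argo
qed (simp add: free_graphs_iff)

section \<open>Prisms with exponentially many minimal separators\<close>

text \<open>
  A vertex \<open>u\<close> of the base graph has the copies \<open>2u\<close> and \<open>2u + 1\<close>, told apart by their parity and joined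
  by an edge if \<open>u \<in> M\<close>.
\<close>

definition prism_adj :: "(nat \<Rightarrow> nat \<Rightarrow> bool) \<Rightarrow> nat set \<Rightarrow> nat \<Rightarrow> nat \<Rightarrow> bool" where
  "prism_adj e M x y \<longleftrightarrow> (even x \<longleftrightarrow> even y) \<and> e (x div 2) (y div 2) \<or>
     (even x \<longleftrightarrow> odd y) \<and> x div 2 = y div 2 \<and> x div 2 \<in> M"

definition prism :: "nat \<Rightarrow> (nat \<Rightarrow> nat \<Rightarrow> bool) \<Rightarrow> nat set \<Rightarrow> nat graph" where
  "prism m e M = Graph {..<2 * m} {{x, y} | x y. x < 2 * m \<and> y < 2 * m \<and> prism_adj e M x y}"

lemma same_copy: "even x = even y \<Longrightarrow> x div 2 = y div 2 \<Longrightarrow> x = (y :: nat)"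
  by (metis bit_eq_rec)

locale prism_base =
  fixes m :: nat and e :: "nat \<Rightarrow> nat \<Rightarrow> bool" and M :: "nat set" and c0 :: nat
  assumes e_sym: "e u v \<Longrightarrow> e v u" and e_irrefl: "\<not> e u u"
    and M_sub: "M \<subseteq> {..<m}" and c0: "c0 < m" "c0 \<notin> M"
    and connected: "\<And>c. c < m \<Longrightarrow> c \<notin> M \<Longrightarrow>
      (c0, c) \<in> {(x, y). x < m \<and> y < m \<and> x \<notin> M \<and> y \<notin> M \<and> e x y}\<^sup>*"
    and attached: "\<And>u. u \<in> M \<Longrightarrow> \<exists>c<m. c \<notin> M \<and> e c u"
begin

lemma prism_adj_sym: "prism_adj e M x y \<Longrightarrow> prism_adj e M y x"
  unfolding prism_adj_def using e_sym by metis

lemma adjacent_prism: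
  "adjacent (prism m e M) x y \<longleftrightarrow> x < 2 * m \<and> y < 2 * m \<and> prism_adj e M x y"
  unfolding adjacent_def prism_def graph.sel mem_Collect_eq doubleton_eq_iff
  using prism_adj_sym by blast

lemma prism_adj_irrefl: "\<not> prism_adj e M x x"
  using e_irrefl by (simp add: prism_adj_def)

lemma simple_prism: "simple_graph (prism m e M)"
proof -
  have "card {x, y} = 2" if "prism_adj e M x y" for x y
    using that prism_adj_irrefl by (metis card_2_iff)
  moreover have "{..<2 * m} \<noteq> {}" using c0 by (auto simp: lessThan_empty_iff)
  ultimately show ?thesis by (auto simp: simple_graph_def prism_def)
qed

lemma verts_prism: "verts (prism m e M) = {..<2 * m}"
  by (simp add: prism_def)

text \<open>
  Choosing, for each \<open>u \<in> M\<close>, one end of its matching edge separates the two copies of \<open>c0\<close>; giving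
  back a chosen end reopens that edge, and both copies remain connected outside \<open>M\<close>.
\<close>

definition transversal :: "nat set \<Rightarrow> nat set" where
  "transversal I = (\<lambda>u. 2 * u) ` I \<union> (\<lambda>u. 2 * u + 1) ` (M - I)"

lemma even_mem_transversal: "2 * u \<in> transversal I \<longleftrightarrow> u \<in> I"
  by (auto simp: transversal_def) presburger

lemma odd_mem_transversal: "2 * u + 1 \<in> transversal I \<longleftrightarrow> u \<in> M \<and> u \<notin> I"
  by (auto simp: transversal_def) presburger+

lemma inj_on_transversal: "inj_on transversal (Pow M)"
  by (rule inj_onI) (metis even_mem_transversal set_eq_iff)

lemma mem_transversal_div: "I \<subseteq> M \<Longrightarrow> x \<in> transversal I \<Longrightarrow> x div 2 \<in> M"
  by (auto simp: transversal_def)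

lemma copy_connected:
  assumes T: "\<And>x. x \<in> T \<Longrightarrow> x div 2 \<in> M" and s: "s < 2" and c: "c < m" "c \<notin> M"
  shows "(2 * c0 + s, 2 * c + s) \<in> (avoiding (prism m e M) T)\<^sup>*"
  using connected[OF c]
proof (induction rule: rtrancl_induct)
  case base
  show ?case by simp
next
  case (step x y)
  have "(2 * x + s) div 2 = x" "(2 * y + s) div 2 = y" "even (2 * x + s) = even (2 * y + s)"
    using s by auto
  then have "(2 * x + s, 2 * y + s) \<in> avoiding (prism m e M) T"
    using step.hyps(2) T[of "2 * x + s"] T[of "2 * y + s"] s
    by (auto simp: avoiding_def adjacent_prism prism_adj_def)
  with step.IH show ?case by (rule rtrancl_into_rtrancl)
qed

lemma transversal_minimal_separator:
  assumes I: "I \<subseteq> M"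
  shows "transversal I \<in> minimal_separators (prism m e M)"
proof -
  let ?G = "prism m e M"
  have c0V: "2 * c0 < 2 * m" "2 * c0 + 1 < 2 * m" using c0 by auto
  have div_M: "x div 2 \<in> M" if "x \<in> transversal I" for x using mem_transversal_div[OF I that] .
  have sub: "transversal I \<subseteq> verts ?G - {2 * c0, 2 * c0 + 1}"
  proof
    fix x assume "x \<in> transversal I"
    then have "x div 2 \<in> M" by (rule div_M)
    then have "x div 2 < m" "x div 2 \<noteq> c0" using M_sub c0 by auto
    then show "x \<in> verts ?G - {2 * c0, 2 * c0 + 1}" unfolding verts_prism by auto
  qed
  have "even x" if "(2 * c0, x) \<in> (avoiding ?G (transversal I))\<^sup>*" for x
    using that
  proof (induction rule: rtrancl_induct)
    case (step x y)
    show ?case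
    proof (rule ccontr)
      assume "odd y"
      then have "x div 2 = y div 2" "x div 2 \<in> M" "x \<notin> transversal I" "y \<notin> transversal I"
        using step.hyps(2) step.IH by (auto simp: avoiding_def adjacent_prism prism_adj_def)
      moreover have "x = 2 * (x div 2)" "y = 2 * (y div 2) + 1"
        using step.IH \<open>odd y\<close> by auto
      ultimately show False using even_mem_transversal odd_mem_transversal by metis
    qed
  qed simp
  then have "(2 * c0, 2 * c0 + 1) \<notin> (avoiding ?G (transversal I))\<^sup>*" by fastforce
  then have sep: "separator ?G (2 * c0) (2 * c0 + 1) (transversal I)"
    using sub c0V by (simp add: separator_iff[OF simple_prism] verts_prism)
  have "\<not> separator ?G (2 * c0) (2 * c0 + 1) T" if T: "T \<subset> transversal I" for T
  proof -
    obtain x where x: "x \<in> transversal I" "x \<notin> T" using T by blast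
    define u where "u = x div 2"
    have u: "u \<in> M" "u < m" using div_M[OF x(1)] M_sub by (auto simp: u_def)
    have x_cases: "x = 2 * u \<or> x = 2 * u + 1" unfolding u_def by presburger
    have uT: "2 * u \<notin> T" "2 * u + 1 \<notin> T"
      using x x_cases T even_mem_transversal odd_mem_transversal by blast+
    obtain c where c: "c < m" "c \<notin> M" "e c u" using attached u by blast
    have TM: "x div 2 \<in> M" if "x \<in> T" for x using that T div_M by blast
    have cT: "2 * c \<notin> T" "2 * c + 1 \<notin> T" using TM[of "2 * c"] TM[of "2 * c + 1"] c by auto
    note step = rtrancl_into_rtrancl[where r = "avoiding ?G T"]
    have "(2 * c0, 2 * c) \<in> (avoiding ?G T)\<^sup>*"
      using copy_connected[of T 0, OF TM _ c(1,2)] by simp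
    moreover have "(2 * c, 2 * u) \<in> avoiding ?G T"
      using c u cT uT by (simp add: avoiding_def adjacent_prism prism_adj_def)
    moreover have "(2 * u, 2 * u + 1) \<in> avoiding ?G T"
      using u uT by (simp add: avoiding_def adjacent_prism prism_adj_def)
    moreover have "(2 * u + 1, 2 * c + 1) \<in> avoiding ?G T"
      using c u cT uT e_sym[OF c(3)] by (simp add: avoiding_def adjacent_prism prism_adj_def)
    moreover have "(2 * c + 1, 2 * c0 + 1) \<in> (avoiding ?G T)\<^sup>*"
      by (rule avoiding_rtrancl_sym, rule copy_connected[of T 1, OF TM _ c(1,2)]) simp_all
    ultimately have "(2 * c0, 2 * c0 + 1) \<in> (avoiding ?G T)\<^sup>*"
      by (meson rtrancl_into_rtrancl rtrancl_trans)
    then show ?thesis by (simp add: separator_iff[OF simple_prism])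
  qed
  then have "minimal_ab_separator ?G (2 * c0) (2 * c0 + 1) (transversal I)"
    using sep by (simp add: minimal_ab_separator_def)
  moreover have "\<not> adjacent ?G (2 * c0) (2 * c0 + 1)"
    using c0 by (simp add: adjacent_prism prism_adj_def)
  moreover have "2 * c0 \<in> verts ?G" "2 * c0 + 1 \<in> verts ?G" "2 * c0 \<noteq> 2 * c0 + 1"
    using c0V by (auto simp: verts_prism)
  ultimately show ?thesis unfolding minimal_separators_def by blast
qed

lemma many_minimal_separators: "2 ^ card M \<le> num_minimal_separators (prism m e M)"
proof -
  have fin: "finite M" using M_sub finite_subset by blast
  have "minimal_separators (prism m e M) \<subseteq> Pow (verts (prism m e M))"
    by (auto simp: minimal_separators_def minimal_ab_separator_def separator_def)
  then have "finite (minimal_separators (prism m e M))"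
    using finite_subset by (fastforce simp: prism_def)
  moreover have "transversal ` Pow M \<subseteq> minimal_separators (prism m e M)"
    using transversal_minimal_separator by blast
  ultimately have "card (transversal ` Pow M) \<le> card (minimal_separators (prism m e M))"
    by (intro card_mono)
  then show ?thesis
    using fin by (simp add: card_image[OF inj_on_transversal] card_Pow num_minimal_separators_def)
qed

text \<open>A vertex has at most one neighbour in the other copy, so a triangle stays within one copy.\<close>

lemma prism_triangle:
  assumes "prism_adj e M x y" "prism_adj e M y z" "prism_adj e M x z"
  shows "even x = even y" "even y = even z"
    "e (x div 2) (y div 2)" "e (y div 2) (z div 2)" "e (x div 2) (z div 2)"
proof -
  have "even x = even y" "even y = even z"
    using assms e_irrefl unfolding prism_adj_def by metis+
  then show "even x = even y" "even y = even z"
    "e (x div 2) (y div 2)" "e (y div 2) (z div 2)" "e (x div 2) (z div 2)"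
    using assms unfolding prism_adj_def by auto
qed

lemma no_K3:
  assumes "\<And>i j k. e i j \<Longrightarrow> e j k \<Longrightarrow> e i k \<Longrightarrow> False"
  shows "\<not> embeds (complete_graph 3) (prism m e M)"
proof
  assume "embeds (complete_graph 3) (prism m e M)"
  then obtain f where f: "\<forall>u\<in>verts (complete_graph 3). \<forall>v\<in>verts (complete_graph 3).
      adjacent (complete_graph 3) u v \<longleftrightarrow> adjacent (prism m e M) (f u) (f v)"
    unfolding embeds_def by blast
  have "prism_adj e M (f u) (f v)" if "u < 3" "v < 3" "u \<noteq> v" for u v
    using f that by (simp add: verts_complete_graph adjacent_complete_graph adjacent_prism)
  from this[of 0 1] this[of 1 2] this[of 0 2]
  have "prism_adj e M (f 0) (f 1)" "prism_adj e M (f 1) (f 2)" "prism_adj e M (f 0) (f 2)"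
    by simp_all
  from assms[OF prism_triangle(3-5)[OF this]] show False .
qed

lemma no_K4_diamond:
  assumes unique: "\<And>i j k l. e k l \<Longrightarrow> e i k \<Longrightarrow> e i l \<Longrightarrow> e j k \<Longrightarrow> e j l \<Longrightarrow> i = j"
  shows "\<not> contains (prism m e M) K4_pat" "\<not> contains (prism m e M) diamond_pat"
proof -
  have *: "a = b"
    if "prism_adj e M c d" "prism_adj e M a c" "prism_adj e M a d"
      "prism_adj e M b c" "prism_adj e M b d" for a b c d
  proof -
    note A = prism_triangle[OF that(2,1,3)] and B = prism_triangle[OF that(4,1,5)]
    have "a div 2 = b div 2" using unique A B by blast
    then show ?thesis using same_copy[of a b] A(1) B(1) by blast
  qed
  show "\<not> contains (prism m e M) K4_pat" "\<not> contains (prism m e M) diamond_pat"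
    using * by (fastforce simp: contains_def pattern_def K4_pat_def diamond_pat_def adjacent_prism)+
qed

text \<open>
  The edges between the copies that a 4-cycle uses are even in number. Two consecutive ones would end
  in the same vertex; two opposite ones would join an edge inside \<open>M\<close> to its copy.
\<close>

lemma no_C4:
  assumes M: "\<And>u v. u \<in> M \<Longrightarrow> v \<in> M \<Longrightarrow> \<not> e u v"
    and C4: "\<And>i j k l. e i j \<Longrightarrow> e j k \<Longrightarrow> e k l \<Longrightarrow> e l i \<Longrightarrow> i \<noteq> k \<Longrightarrow> j \<noteq> l \<Longrightarrow> e i k \<or> e j l"
  shows "\<not> contains (prism m e M) C4_pat"
proof
  assume "contains (prism m e M) C4_pat"
  then obtain a b c d where cyc: "prism_adj e M a b" "prism_adj e M b c" "prism_adj e M c d"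
      "prism_adj e M a d" "\<not> prism_adj e M a c" "\<not> prism_adj e M b d" "a \<noteq> c" "b \<noteq> d"
    by (auto simp: contains_def pattern_def C4_pat_def adjacent_prism)
  have da: "prism_adj e M d a" using cyc(4) by (rule prism_adj_sym)
  have no_two: "x = z" if "prism_adj e M x y" "prism_adj e M y z" "even x \<noteq> even y" "even y \<noteq> even z"
    for x y z
  proof (rule same_copy)
    show "even x = even z" using that(3,4) by blast
    show "x div 2 = z div 2" using that unfolding prism_adj_def by metis
  qed
  have no_opposite: "even x = even y"
    if "prism_adj e M x y" "prism_adj e M y z" "prism_adj e M z w"
      "even y = even z" "even z \<noteq> even w" for x y z w
    using that M unfolding prism_adj_def by metis
  show False
  proof (cases "even a = even b \<and> even b = even c \<and> even c = even d")
    case True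
    then have "a div 2 \<noteq> c div 2" "b div 2 \<noteq> d div 2" using cyc same_copy by blast+
    then show False
      using C4[of "a div 2" "b div 2" "c div 2" "d div 2"] cyc(1-6) da True
      unfolding prism_adj_def by metis
  next
    case False
    then show False
      using no_two[OF cyc(1,2)] no_two[OF cyc(2,3)] no_two[OF cyc(3) da] no_two[OF da cyc(1)]
        no_opposite[OF cyc(1,2,3)] no_opposite[OF cyc(2,3) da] cyc(7,8) by metis
  qed
qed

end

section \<open>The three obstructions are not tame\<close>

text \<open>
  The statement is proved for all bases \<open>b\<close> at once: writing \<open>b ^ n = s ^ n * s ^ n\<close>, one factor absorbs
  the new linear factor of the polynomial and the other is left for the induction hypothesis.
\<close>

lemma poly_over_exponential_tendsto_0:
  fixes p :: "real poly" and c d b :: real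
  assumes "1 < b"
  shows "(\<lambda>n. poly p (c * real n + d) / b ^ n) \<longlonglongrightarrow> 0"
  using assms
proof (induction p arbitrary: b)
  case 0
  show ?case by simp
next
  case (pCons a p)
  define s where "s = sqrt b"
  have s: "1 < s" "b = s * s" using pCons.prems by (auto simp: s_def)
  have inv: "(\<lambda>n. inverse x ^ n) \<longlonglongrightarrow> 0" if "1 < x" for x :: real
    using that by (intro LIMSEQ_power_zero) (auto simp: field_simps)
  have "(\<lambda>n. c * (real n / s ^ n) + d * inverse s ^ n) \<longlonglongrightarrow> c * 0 + d * 0"
    using lim_n_over_pown[of s] s(1) by (intro tendsto_intros inv) auto
  then have "(\<lambda>n. a * inverse b ^ n + (c * (real n / s ^ n) + d * inverse s ^ n) *
      (poly p (c * real n + d) / s ^ n)) \<longlonglongrightarrow> a * 0 + (c * 0 + d * 0) * 0"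
    by (intro tendsto_add[OF tendsto_mult[OF tendsto_const inv[OF pCons.prems]]]
        tendsto_mult pCons.IH[OF s(1)])
  moreover have "a * inverse b ^ n + (c * (real n / s ^ n) + d * inverse s ^ n) *
      (poly p (c * real n + d) / s ^ n) = poly (pCons a p) (c * real n + d) / b ^ n" for n
    using s by (simp add: s(2) power_mult_distrib power_inverse field_simps)
  ultimately show ?case by simp
qed

lemma not_tame_if_exponential:
  assumes "\<And>n. \<exists>G\<in>\<G>. card (verts G) = c * n + d \<and> 2 ^ n \<le> num_minimal_separators G"
  shows "\<not> tame \<G>"
proof
  assume "tame \<G>"
  then obtain p where p: "\<And>G. G \<in> \<G> \<Longrightarrow>
      real (num_minimal_separators G) \<le> poly p (real (card (verts G)))"
    unfolding tame_def by blast
  have "eventually (\<lambda>n. poly p (real c * real n + real d) / 2 ^ n < 1) sequentially"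
    using order_tendstoD(2)[OF poly_over_exponential_tendsto_0[of 2 p "real c" "real d"], of 1]
    by simp
  then obtain n where n: "poly p (real c * real n + real d) < 2 ^ n"
    by (auto simp: eventually_sequentially)
  obtain G where G: "G \<in> \<G>" "card (verts G) = c * n + d" "2 ^ n \<le> num_minimal_separators G"
    using assms by blast
  have "(2 :: real) ^ n \<le> real (num_minimal_separators G)"
    using G(3) by (metis of_nat_le_iff of_nat_numeral of_nat_power)
  also have "\<dots> \<le> poly p (real c * real n + real d)"
    using p[OF G(1)] G(2) by simp
  finally show False using n by simp
qed

text \<open>
  The base graph is complete: two cliques joined by a matching. Of three vertices two lie in the same
  clique, and the two triangles of a diamond would lie in the same clique.
\<close>

lemma not_tame_3P1_diamond_free: "\<not> tame (free_graphs {copies 3 (path_graph 1), diamond})"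
proof (rule not_tame_if_exponential[where c = 2 and d = 2])
  fix n :: nat
  define M where "M = {1..n}"
  interpret prism_base "Suc n" "(\<noteq>)" M 0
  proof
    fix c assume "c < Suc n" "c \<notin> M"
    then have "c = 0" by (auto simp: M_def)
    then show "(0, c) \<in> {(x, y). x < Suc n \<and> y < Suc n \<and> x \<notin> M \<and> y \<notin> M \<and> x \<noteq> y}\<^sup>*" by simp
  qed (auto simp: M_def intro: exI[of _ 0])
  let ?G = "prism (Suc n) (\<noteq>) M"
  have "\<not> contains ?G diamond_pat"
  proof
    assume "contains ?G diamond_pat"
    then obtain a b c d where "prism_adj (\<noteq>) M a c" "prism_adj (\<noteq>) M a d" "prism_adj (\<noteq>) M b c"
      "prism_adj (\<noteq>) M b d" "prism_adj (\<noteq>) M c d" "\<not> prism_adj (\<noteq>) M a b" "a \<noteq> b"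
      by (auto simp: contains_def pattern_def diamond_pat_def adjacent_prism)
    then have "even a = even b" using prism_triangle(1)[of a c d] prism_triangle(1)[of b c d] by blast
    then show False
      using \<open>\<not> prism_adj (\<noteq>) M a b\<close> \<open>a \<noteq> b\<close> same_copy[of a b] by (auto simp: prism_adj_def)
  qed
  then have "\<not> embeds diamond ?G" using contains_embeds contains_named(2) by blast
  moreover have "\<not> embeds (copies 3 (path_graph 1)) ?G"
  proof
    assume "embeds (copies 3 (path_graph 1)) ?G"
    then obtain f where f: "inj_on f ((\<lambda>i. prod_encode (i, 0)) ` {..<3})"
        "f ` (\<lambda>i. prod_encode (i, 0)) ` {..<3} \<subseteq> verts ?G"
        "\<forall>u\<in>(\<lambda>i. prod_encode (i, 0)) ` {..<3}. \<forall>v\<in>(\<lambda>i. prod_encode (i, 0)) ` {..<3}.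
          \<not> adjacent ?G (f u) (f v)"
      unfolding embeds_def verts_copies_P1 using not_adjacent_copies_P1 by metis
    define g where "g i = f (prod_encode (i, 0))" for i
    have "even (g i) \<noteq> even (g j)" if ij: "i < 3" "j < 3" "i \<noteq> j" for i j
    proof
      assume even: "even (g i) = even (g j)"
      have mem: "prod_encode (i, 0) \<in> (\<lambda>i. prod_encode (i, 0)) ` {..<3}"
        "prod_encode (j, 0) \<in> (\<lambda>i. prod_encode (i, 0)) ` {..<3}" using ij by auto
      then have "g i \<noteq> g j" "\<not> adjacent ?G (g i) (g j)"
        using f(1,3) ij(3) by (auto simp: g_def inj_on_def)
      moreover have "g i \<in> verts ?G" "g j \<in> verts ?G" using f(2) mem by (auto simp: g_def)
      ultimately show False
        using even same_copy[of "g i" "g j"] by (simp add: adjacent_prism prism_adj_def verts_prism)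
    qed
    from this[of 0 1] this[of 1 2] this[of 0 2] show False by auto
  qed
  ultimately have "?G \<in> free_graphs {copies 3 (path_graph 1), diamond}"
    using simple_prism by (simp add: free_graphs_iff)
  moreover have "card M = n" by (simp add: M_def)
  ultimately show "\<exists>G\<in>free_graphs {copies 3 (path_graph 1), diamond}.
      card (verts G) = 2 * n + 2 \<and> 2 ^ n \<le> num_minimal_separators G"
    using many_minimal_separators by (intro bexI[of _ ?G]) (auto simp: verts_prism)
qed

text \<open>
  The base graph is a star whose leaves are matched, so that the two centres are joined by disjoint
  paths of length three.
\<close>

lemma not_tame_K3_C4_free: "\<not> tame (free_graphs {complete_graph 3, cycle_graph 4})"
proof (rule not_tame_if_exponential[where c = 2 and d = 2])
  fix n :: nat
  define M where "M = {1..n}"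
  define e where "e u v \<longleftrightarrow> (u = 0) \<noteq> (v = 0)" for u v :: nat
  interpret prism_base "Suc n" e M 0
  proof
    fix c assume "c < Suc n" "c \<notin> M"
    then have "c = 0" by (auto simp: M_def)
    then show "(0, c) \<in> {(x, y). x < Suc n \<and> y < Suc n \<and> x \<notin> M \<and> y \<notin> M \<and> e x y}\<^sup>*" by simp
  qed (auto simp: M_def e_def intro: exI[of _ 0])
  let ?G = "prism (Suc n) e M"
  have "\<not> embeds (complete_graph 3) ?G" by (rule no_K3) (auto simp: e_def)
  moreover have "\<not> contains ?G C4_pat" by (rule no_C4) (auto simp: e_def M_def)
  then have "\<not> embeds (cycle_graph 4) ?G" using contains_embeds contains_named(4) by blast
  ultimately have "?G \<in> free_graphs {complete_graph 3, cycle_graph 4}"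
    using simple_prism by (simp add: free_graphs_iff)
  moreover have "card M = n" by (simp add: M_def)
  ultimately show "\<exists>G\<in>free_graphs {complete_graph 3, cycle_graph 4}.
      card (verts G) = 2 * n + 2 \<and> 2 ^ n \<le> num_minimal_separators G"
    using many_minimal_separators by (intro bexI[of _ ?G]) (auto simp: verts_prism)
qed

text \<open>
  The line graph of a caterpillar: the even numbers form a path, and each odd number forms a
  triangle with its two even neighbours. Matching the odd vertices of two copies gives the line
  graph of a ladder with subdivided rungs.
\<close>

definition tri_path :: "nat \<Rightarrow> nat \<Rightarrow> bool" where
  "tri_path u v \<longleftrightarrow> u = v + 1 \<or> v = u + 1 \<or> even u \<and> (u = v + 2 \<or> v = u + 2)"

lemma tri_path_sym: "tri_path u v \<Longrightarrow> tri_path v u"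
  unfolding tri_path_def by auto

lemma tri_path_nbrs_odd: "odd u \<Longrightarrow> tri_path u i \<Longrightarrow> tri_path u j \<Longrightarrow> i \<noteq> j \<Longrightarrow> tri_path i j"
  unfolding tri_path_def by presburger

lemma tri_path_nbrs_above: "tri_path u i \<Longrightarrow> tri_path u j \<Longrightarrow> u < i \<Longrightarrow> u < j \<Longrightarrow> i \<noteq> j \<Longrightarrow> tri_path i j"
  unfolding tri_path_def by presburger

lemma tri_path_nbrs_below: "tri_path u i \<Longrightarrow> tri_path u j \<Longrightarrow> i < u \<Longrightarrow> j < u \<Longrightarrow> i \<noteq> j \<Longrightarrow> tri_path i j"
  unfolding tri_path_def by presburger

lemma tri_path_irrefl: "\<not> tri_path u u"
  by (simp add: tri_path_def)

lemma tri_path_nbrs_even: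
  assumes "tri_path u i" "tri_path u j" "tri_path u k" "i \<noteq> j" "i \<noteq> k" "j \<noteq> k"
  shows "tri_path i j \<or> tri_path i k \<or> tri_path j k"
proof -
  have "u \<noteq> i" "u \<noteq> j" "u \<noteq> k" using assms tri_path_irrefl by blast+
  then show ?thesis
    using assms tri_path_nbrs_above tri_path_nbrs_below by (meson linorder_neqE_nat)
qed

text \<open>
  The two cycle neighbours of the smallest vertex both lie above it.
\<close>

lemma tri_path_C4:
  assumes "tri_path i j" "tri_path j k" "tri_path k l" "tri_path l i" "i \<noteq> k" "j \<noteq> l"
  shows "tri_path i k \<or> tri_path j l"
proof -
  have neq: "i \<noteq> j" "j \<noteq> k" "k \<noteq> l" "l \<noteq> i" using assms tri_path_irrefl by blast+
  consider "i < j \<and> i < l" | "j < i \<and> j < k" | "k < j \<and> k < l" | "l < k \<and> l < i"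
    using neq by linarith
  then show ?thesis
    by cases (use assms tri_path_nbrs_above tri_path_sym in blast)+
qed

text \<open>
  Triangles are \<open>{c, c + 1, c + 2}\<close> with \<open>c\<close> even, so two vertices of one determine the third.
\<close>

lemma tri_path_common_nbr:
  assumes "tri_path k l" "tri_path i k" "tri_path i l" "tri_path j k" "tri_path j l"
  shows "i = j"
proof -
  have ordered: "i = j"
    if ord: "k < l" "tri_path k l" "tri_path i k" "tri_path i l" "tri_path j k" "tri_path j l" for k l
  proof -
    consider "l = k + 2" "even k" | "l = k + 1" "even k" | "l = k + 1" "odd k"
      using ord(1,2) unfolding tri_path_def by fastforce
    then show ?thesis
    proof cases
      case 1
      then have "x = k + 1" if "tri_path x k" "tri_path x l" for x
        using that unfolding tri_path_def by presburger
      then show ?thesis using ord(3-6) by metis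
    next
      case 2
      then have "x = k + 2" if "tri_path x k" "tri_path x l" for x
        using that unfolding tri_path_def by presburger
      then show ?thesis using ord(3-6) by metis
    next
      case 3
      then have "x + 1 = k" if "tri_path x k" "tri_path x l" for x
        using that unfolding tri_path_def by presburger
      then show ?thesis using ord(3-6) by (metis add_right_cancel)
    qed
  qed
  have "k \<noteq> l" using assms tri_path_irrefl by blast
  then show ?thesis
    using ordered[of k l] ordered[of l k] assms tri_path_sym[OF assms(1)] by (meson linorder_neqE_nat)
qed

lemma tri_path_even_connected:
  assumes "c \<le> n"
  shows "(0, 2 * c) \<in> {(x, y). x < Suc (2 * n) \<and> y < Suc (2 * n) \<and> even x \<and> even y \<and> tri_path x y}\<^sup>*"
  using assms
proof (induction c)
  case (Suc c)
  then have "(2 * c, 2 * Suc c) \<in>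
      {(x, y). x < Suc (2 * n) \<and> y < Suc (2 * n) \<and> even x \<and> even y \<and> tri_path x y}"
    by (simp add: tri_path_def)
  then show ?case using Suc by (meson Suc_leD rtrancl_into_rtrancl)
qed simp

text \<open>
  A vertex outside the matching has only neighbours below and above it in its own copy, and both groups
  are cliques. A matched vertex has two adjacent neighbours in its own copy and one in the other. So no
  vertex is the centre of a claw.
\<close>

lemma not_tame_claw_K4_C4_diamond_free:
  "\<not> tame (free_graphs {claw, complete_graph 4, cycle_graph 4, diamond})"
proof (rule not_tame_if_exponential[where c = 4 and d = 2])
  fix n :: nat
  define M where "M = (\<lambda>i. 2 * i + 1) ` {..<n}"
  have M: "u \<in> M \<longleftrightarrow> odd u \<and> u < Suc (2 * n)" for u
    by (auto simp: M_def image_iff elim!: oddE)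
  interpret prism_base "Suc (2 * n)" tri_path M 0
  proof
    fix c assume c: "c < Suc (2 * n)" "c \<notin> M"
    then have "even c" by (simp add: M)
    then obtain k where k: "c = 2 * k" by blast
    then have "k \<le> n" using c by simp
    have rel: "{(x, y). x < Suc (2 * n) \<and> y < Suc (2 * n) \<and> x \<notin> M \<and> y \<notin> M \<and> tri_path x y} =
        {(x, y). x < Suc (2 * n) \<and> y < Suc (2 * n) \<and> even x \<and> even y \<and> tri_path x y}"
      by (auto simp: M)
    show "(0, c) \<in> {(x, y). x < Suc (2 * n) \<and> y < Suc (2 * n) \<and> x \<notin> M \<and> y \<notin> M \<and> tri_path x y}\<^sup>*"
      unfolding rel k using tri_path_even_connected[OF \<open>k \<le> n\<close>] .
  next
    fix u assume "u \<in> M"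
    then have "u + 1 < Suc (2 * n)" "even (u + 1)" by (auto simp: M elim!: oddE)
    then show "\<exists>c<Suc (2 * n). c \<notin> M \<and> tri_path c u"
      by (intro exI[of _ "u + 1"]) (auto simp: M tri_path_def)
  qed (auto simp: M tri_path_def)
  let ?G = "prism (Suc (2 * n)) tri_path M"
  have "\<not> contains ?G K4_pat" "\<not> contains ?G diamond_pat"
    using no_K4_diamond tri_path_common_nbr by blast+
  moreover have "\<not> contains ?G C4_pat"
    by (rule no_C4) (use tri_path_C4 in \<open>auto simp: M tri_path_def\<close>)
  moreover have "\<not> contains ?G claw_pat"
  proof
    assume "contains ?G claw_pat"
    then obtain x a b c where claw: "prism_adj tri_path M x a" "prism_adj tri_path M x b"
      "prism_adj tri_path M x c" "\<not> prism_adj tri_path M a b" "\<not> prism_adj tri_path M a c"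
      "\<not> prism_adj tri_path M b c" "a \<noteq> b" "a \<noteq> c" "b \<noteq> c"
      by (auto simp: contains_def pattern_def claw_pat_def adjacent_prism)
    have other: "y = z" if "prism_adj tri_path M x y" "prism_adj tri_path M x z"
      "even x \<noteq> even y" "even x \<noteq> even z" for y z
    proof (rule same_copy)
      show "even y = even z" using that(3,4) by blast
      show "y div 2 = z div 2" using that unfolding prism_adj_def by metis
    qed
    have same: "\<not> tri_path (y div 2) (z div 2) \<and> y div 2 \<noteq> z div 2"
      if "\<not> prism_adj tri_path M y z" "y \<noteq> z" "even x = even y" "even x = even z" for y z
      using that same_copy[of y z] unfolding prism_adj_def by auto
    have nbr: "tri_path (x div 2) (y div 2)" if "prism_adj tri_path M x y" "even x = even y" for y
      using that unfolding prism_adj_def by auto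
    have odd_two: False if "odd (x div 2)" "prism_adj tri_path M x y" "prism_adj tri_path M x z"
      "\<not> prism_adj tri_path M y z" "y \<noteq> z" "even x = even y" "even x = even z" for y z
      using tri_path_nbrs_odd[OF that(1) nbr[OF that(2,6)] nbr[OF that(3,7)]] same[OF that(4-7)] by blast
    show False
    proof (cases "odd (x div 2)")
      case True
      then show False
        using odd_two[OF True claw(1,2,4,7)] odd_two[OF True claw(1,3,5,8)]
          odd_two[OF True claw(2,3,6,9)] other[OF claw(1,2)] other[OF claw(1,3)]
          other[OF claw(2,3)] claw(7-9) by blast
    next
      case False
      then have "x div 2 \<notin> M" by (simp add: M)
      then have even: "even x = even y" if "prism_adj tri_path M x y" for y
        using that unfolding prism_adj_def by auto
      show False
        using tri_path_nbrs_even[of "x div 2" "a div 2" "b div 2" "c div 2"] nbr[OF claw(1)] nbr[OF claw(2)]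
          nbr[OF claw(3)] even[OF claw(1)] even[OF claw(2)] even[OF claw(3)]
          same[OF claw(4,7)] same[OF claw(5,8)] same[OF claw(6,9)]
        by blast
    qed
  qed
  ultimately have "?G \<in> free_graphs {claw, complete_graph 4, cycle_graph 4, diamond}"
    using simple_prism contains_embeds contains_named by (simp add: free_graphs_iff) blast
  moreover have "card M = n" by (simp add: M_def card_image inj_on_def)
  ultimately show "\<exists>G\<in>free_graphs {claw, complete_graph 4, cycle_graph 4, diamond}.
      card (verts G) = 4 * n + 2 \<and> 2 ^ n \<le> num_minimal_separators G"
    using many_minimal_separators by (intro bexI[of _ ?G]) (auto simp: verts_prism)
qed

lemma not_tame_mono: "\<not> tame \<G> \<Longrightarrow> \<G> \<subseteq> \<G>' \<Longrightarrow> \<not> tame \<G>'"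
  unfolding tame_def by blast

theorem theorem4:
  fixes \<F> :: "nat graph set"
  assumes "\<And>H. H \<in> \<F> \<Longrightarrow> simple_graph H \<and> card (verts H) \<le> 4"
    and "\<not> \<F> \<doteq> {copies 4 (path_graph 1), cycle_graph 4}"
    and "\<not> \<F> \<doteq> {copies 4 (path_graph 1), cycle_graph 4, claw}"
  shows "\<not> tame (free_graphs \<F>) \<longleftrightarrow>
     {copies 3 (path_graph 1), diamond} \<unlhd> \<F> \<or>
     {claw, complete_graph 4, cycle_graph 4, diamond} \<unlhd> \<F> \<or>
     {complete_graph 3, cycle_graph 4} \<unlhd> \<F>"
proof
  assume "\<not> tame (free_graphs \<F>)"
  then show "{copies 3 (path_graph 1), diamond} \<unlhd> \<F> \<or>
     {claw, complete_graph 4, cycle_graph 4, diamond} \<unlhd> \<F> \<or>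
     {complete_graph 3, cycle_graph 4} \<unlhd> \<F>"
    using tame_if_no_obstruction[OF assms] by blast
next
  assume "{copies 3 (path_graph 1), diamond} \<unlhd> \<F> \<or>
     {claw, complete_graph 4, cycle_graph 4, diamond} \<unlhd> \<F> \<or>
     {complete_graph 3, cycle_graph 4} \<unlhd> \<F>"
  then show "\<not> tame (free_graphs \<F>)"
    unfolding family_le_def
    using not_tame_mono not_tame_3P1_diamond_free not_tame_claw_K4_C4_diamond_free
      not_tame_K3_C4_free by blast
qed

end
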